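(* Let $\Gamma_1,\dots,\Gamma_k$ be graphs with $d$ vertices (loops and multiple edges allowed) and let $W_1\le S_d,\dots,W_k\le S_d$ be their automorphism groups, respectively. The number of all superpositions of $\Gamma_1,\dots,\Gamma_k$ whose automorphism group consists of even permutations is $$ N\bigl(Z(\varepsilon;p_1,\dots,p_d)\ast Z(1_{W_2};p_1,\dots,p_d)\ast\cdots\ast Z(1_{W_k};p_1,\dots,p_d)\bigr), $$ where $\varepsilon\colon W_1\to K$ is the restriction of the alternating character (sign) of $S_d$ to $W_1$.
   Context: $K$ is an algebraically closed field of characteristic zero; $d,k\ge1$; $S_d$ is the symmetric group; a one-dimensional character of a group $W$ is a homomorphism $W\to K^*$; $1_W$ is the trivial character. The graphs have vertex set $\{1,\dots,d\}$, and the automorphism group of a graph is the group of vertex permutations preserving edge multiplicities. Superpositions of $\Gamma_1,\dots,\Gamma_k$ are the ways of placing the graphs on a common set of $d$ vertices, up to simultaneous relabelling of the vertices; that is, the equivalence classes of tuples $(a_1,\dots,a_k)\in S_d\times\cdots\times S_d$ (where $a_m$ represents the placed copy $a_m\Gamma_m$) under $(a_1,\dots,a_k)\sim(b_1,\dots,b_k)$ iff there are $\zeta\in S_d$ and $w_m\in W_m$ with $b_m=\zeta a_mw_m$ for all $m$. The automorphism group of the superposition represented by $(a_1,\dots,a_k)$ is $a_1W_1a_1^{-1}\cap\cdots\cap a_kW_ka_k^{-1}$ (well defined up to conjugation in $S_d$). For $W\le S_d$ and a one-dimensional character $\chi$ of $W$, $Z(\chi;p_1,\dots,p_d)=|W|^{-1}\sum_{\sigma\in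 W}\chi(\sigma)p_1^{c_1(\sigma)}\cdots p_d^{c_d(\sigma)}$, where $c_s(\sigma)$ is the number of cycles of length $s$ of $\sigma$ and $p_s=\sum_{i\ge0}x_i^s$ are the power sums in $x_0,x_1,\dots$. With $R^d$ the group of generalized characters of $S_d$, $\Lambda^d$ the group of homogeneous degree $d$ symmetric functions with integer coefficients in $x_0,x_1,\dots$, and $ch\colon R^d\to\Lambda^d$ the (bijective) characteristic map $ch(u)=\frac1{d!}\sum_{\sigma\in S_d}u(\sigma)p_1^{c_1(\sigma)}\cdots p_d^{c_d(\sigma)}$, one has $Z(\chi;p_1,\dots,p_d)=ch(\mathrm{ind}_W^{S_d}(\chi))$, and the internal product on $\Lambda^d$ is defined by $ch(u)\ast ch(v)=ch(uv)$. For a polynomial $A$ in $p_1,\dots,p_d$, $N(A)$ is the sum of its coefficients. *)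

theory Defs
  imports
    "HOL-Library.Multiset"
    "HOL-Library.FuncSet"
    "HOL-Library.Uprod"
    "HOL-Library.Poly_Mapping"
    "HOL-Combinatorics.Permutations"
    "HOL-Combinatorics.Orbits"
    "HOL-Computational_Algebra.Polynomial"
    "Jordan_Normal_Form.Matrix"
begin

section \<open>Formal power series in the variables $x_0, x_1, \dots$\<close>

text \<open>
  A monomial is its exponent vector, of type \<^typ>\<open>nat \<Rightarrow>\<^sub>0 nat\<close>; a series is the family of its
  coefficients. Symmetric functions are series of this kind (they are not polynomials, since
  infinitely many variables occur).
\<close>

typedef 'a mseries = "UNIV :: ((nat \<Rightarrow>\<^sub>0 nat) \<Rightarrow> 'a) set"
  morphisms mcoeff Abs_mseries
  by simp

setup_lifting type_definition_mseries

lemma mseries_eqI: "(\<And>m. mcoeff f m = mcoeff g m) \<Longrightarrow> f = g"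
  by transfer auto

definition splittings :: "(nat \<Rightarrow>\<^sub>0 nat) \<Rightarrow> ((nat \<Rightarrow>\<^sub>0 nat) \<times> (nat \<Rightarrow>\<^sub>0 nat)) set" where
  "splittings m = {(a, b). a + b = m}"

lemma finite_splittings [simp]: "finite (splittings m)"
proof -
  define F where "F = {f. \<forall>i. (i \<in> Poly_Mapping.keys m \<longrightarrow> f i \<in> (\<Union>j\<in>Poly_Mapping.keys m. {..Poly_Mapping.lookup m j})) \<and> (i \<notin> Poly_Mapping.keys m \<longrightarrow> f i = (0 :: nat))}"
  have fin: "finite F"
    unfolding F_def by (intro finite_set_of_finite_funs) auto
  have sub: "Poly_Mapping.lookup a \<in> F" if "a + b = m" for a b
  proof -
    have "Poly_Mapping.lookup a i \<le> Poly_Mapping.lookup m i" for i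
      using that by (auto simp: Poly_Mapping.lookup_add)
    note le = this
    have "Poly_Mapping.lookup a i = 0" if "i \<notin> Poly_Mapping.keys m" for i
      using le[of i] that by (simp add: in_keys_iff)
    with le show ?thesis
      unfolding F_def by blast
  qed
  have "splittings m \<subseteq> (\<lambda>(f, g). (Abs_poly_mapping f, Abs_poly_mapping g)) ` (F \<times> F)"
  proof clarify
    fix a b assume "(a, b) \<in> splittings m"
    then have "a + b = m" "b + a = m"
      by (auto simp: splittings_def add.commute)
    then have "Poly_Mapping.lookup a \<in> F" "Poly_Mapping.lookup b \<in> F"
      using sub by simp_all
    then show "(a, b) \<in> (\<lambda>(f, g). (Abs_poly_mapping f, Abs_poly_mapping g)) ` (F \<times> F)"
      by (intro image_eqI[of _ _ "(Poly_Mapping.lookup a, Poly_Mapping.lookup b)"]) auto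
  qed
  then show ?thesis
    using fin by (meson finite_SigmaI finite_imageI finite_subset)
qed

instantiation mseries :: (comm_ring_1) comm_ring_1
begin

lift_definition zero_mseries :: "'a mseries" is "\<lambda>_. 0" .
lift_definition one_mseries :: "'a mseries" is "\<lambda>m. if m = 0 then 1 else 0" .
lift_definition plus_mseries :: "'a mseries \<Rightarrow> 'a mseries \<Rightarrow> 'a mseries" is "\<lambda>f g m. f m + g m" .
lift_definition minus_mseries :: "'a mseries \<Rightarrow> 'a mseries \<Rightarrow> 'a mseries" is "\<lambda>f g m. f m - g m" .
lift_definition uminus_mseries :: "'a mseries \<Rightarrow> 'a mseries" is "\<lambda>f m. - f m" .
lift_definition times_mseries :: "'a mseries \<Rightarrow> 'a mseries \<Rightarrow> 'a mseries"
  is "\<lambda>f g m. \<Sum>(a, b)\<in>splittings m. f a * g b" .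

instance
proof
  fix f g h :: "'a mseries"
  show "f + g + h = f + (g + h)" "f + g = g + f" "0 + f = f" "- f + f = 0" "f - g = f + - g"
    by (transfer; simp add: fun_eq_iff algebra_simps)+
  show "(0 :: 'a mseries) \<noteq> 1"
    by transfer (auto simp: fun_eq_iff)
  show "(f + g) * h = f * h + g * h"
    by transfer (simp add: fun_eq_iff algebra_simps sum.distrib case_prod_unfold)
  show "f * g = g * f"
  proof (transfer, rule ext)
    fix f g :: "(nat \<Rightarrow>\<^sub>0 nat) \<Rightarrow> 'a" and m
    show "(\<Sum>(a, b)\<in>splittings m. f a * g b) = (\<Sum>(a, b)\<in>splittings m. g a * f b)"
      by (rule sum.reindex_bij_witness[of _ prod.swap prod.swap])
         (auto simp: splittings_def ac_simps)
  qed
  show "1 * f = f"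
  proof (transfer, rule ext)
    fix f :: "(nat \<Rightarrow>\<^sub>0 nat) \<Rightarrow> 'a" and m
    have "(\<Sum>(a, b)\<in>splittings m. (if a = 0 then 1 else 0) * f b)
        = (\<Sum>(a, b)\<in>{(0 :: nat \<Rightarrow>\<^sub>0 nat, m)}. (if a = 0 then 1 else 0) * f b)"
    proof (rule sum.mono_neutral_right[OF finite_splittings])
      show "{(0, m)} \<subseteq> splittings m"
        by (simp add: splittings_def)
      show "\<forall>p\<in>splittings m - {(0, m)}. (case p of (a, b) \<Rightarrow> (if a = 0 then 1 else 0) * f b) = 0"
        by (auto simp: splittings_def split: if_splits)
    qed
    then show "(\<Sum>(a, b)\<in>splittings m. (if a = 0 then 1 else 0) * f b) = f m"
      by simp
  qed
  show "f * g * h = f * (g * h)"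
  proof (transfer, rule ext)
    fix f g h :: "(nat \<Rightarrow>\<^sub>0 nat) \<Rightarrow> 'a" and m
    have "(\<Sum>(x, c)\<in>splittings m. (\<Sum>(a, b)\<in>splittings x. f a * g b) * h c)
        = (\<Sum>(p, q)\<in>(SIGMA p:splittings m. splittings (fst p)). f (fst q) * g (snd q) * h (snd p))"
      by (simp add: sum.Sigma sum_distrib_right case_prod_unfold)
    also have "\<dots> = (\<Sum>(p, q)\<in>(SIGMA p:splittings m. splittings (snd p)). f (fst p) * g (fst q) * h (snd q))"
      by (rule sum.reindex_bij_witness[of _
            "\<lambda>((a, y), (b, c)). ((a + b, c), (a, b))" "\<lambda>((x, c), (a, b)). ((a, b + c), (b, c))"])
         (auto simp: splittings_def add.assoc)
    also have "\<dots> = (\<Sum>(a, y)\<in>splittings m. f a * (\<Sum>(b, c)\<in>splittings y. g b * h c))"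
      by (simp add: sum.Sigma sum_distrib_left case_prod_unfold mult.assoc)
    finally show "(\<Sum>(x, c)\<in>splittings m. (\<Sum>(a, b)\<in>splittings x. f a * g b) * h c)
        = (\<Sum>(a, y)\<in>splittings m. f a * (\<Sum>(b, c)\<in>splittings y. g b * h c))" .
  qed
qed

end

lift_definition mscale :: "'a::comm_ring_1 \<Rightarrow> 'a mseries \<Rightarrow> 'a mseries" is "\<lambda>c f m. c * f m" .

text \<open>The power sum $p_s = \sum_{i \ge 0} x_i^s$; only $s \ge 1$ is meaningful.\<close>

lift_definition power_sum :: "nat \<Rightarrow> 'a::comm_ring_1 mseries"
  is "\<lambda>s m. if \<exists>i. m = Poly_Mapping.single i s then 1 else 0" .


section \<open>Polynomials in the power sums\<close>

text \<open>
  A polynomial in $y_1, \dots, y_d$ is a finitely supported family of coefficients indexed by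
  exponent vectors supported in \<open>{1..d}\<close>.
\<close>

definition polys :: "nat \<Rightarrow> ((nat \<Rightarrow>\<^sub>0 nat) \<Rightarrow>\<^sub>0 'a::zero) set" where
  "polys d = {A. \<forall>e\<in>Poly_Mapping.keys A. Poly_Mapping.keys e \<subseteq> {1..d}}"

definition subst_power_sums :: "nat \<Rightarrow> ((nat \<Rightarrow>\<^sub>0 nat) \<Rightarrow>\<^sub>0 'a::comm_ring_1) \<Rightarrow> 'a mseries" where
  "subst_power_sums d A = (\<Sum>e\<in>Poly_Mapping.keys A. mscale (Poly_Mapping.lookup A e) (\<Prod>s=1..d. power_sum s ^ Poly_Mapping.lookup e s))"

definition coeff_sum :: "('b \<Rightarrow>\<^sub>0 'a::comm_monoid_add) \<Rightarrow> 'a" where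
  "coeff_sum A = (\<Sum>e\<in>Poly_Mapping.keys A. Poly_Mapping.lookup A e)"

text \<open>
  $N(f)$, the sum of the coefficients of a series \<open>f\<close> that is a polynomial in $p_1, \dots, p_d$. The polynomial
  is unique in characteristic 0, as $p_1, \dots, p_d$ are then algebraically independent.
\<close>

definition power_sum_coeff_sum :: "nat \<Rightarrow> 'a::field_char_0 mseries \<Rightarrow> 'a" where
  "power_sum_coeff_sum d f = coeff_sum (THE A. A \<in> polys d \<and> subst_power_sums d A = f)"


section \<open>Generalized characters, the characteristic map and the internal product\<close>

abbreviation Sym :: "nat \<Rightarrow> (nat \<Rightarrow> nat) set" where
  "Sym d \<equiv> {\<sigma>. \<sigma> permutes {1..d}}"

definition num_cycles :: "nat \<Rightarrow> nat \<Rightarrow> (nat \<Rightarrow> nat) \<Rightarrow> nat" where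
  "num_cycles d s \<sigma> = card {C \<in> orbit \<sigma> ` {1..d}. card C = s}"

definition cycle_monomial :: "nat \<Rightarrow> (nat \<Rightarrow> nat) \<Rightarrow> 'a::comm_ring_1 mseries" where
  "cycle_monomial d \<sigma> = (\<Prod>s=1..d. power_sum s ^ num_cycles d s \<sigma>)"

text \<open>$Z(\chi; p_1, \dots, p_d)$ for a character $\chi$ of \<open>W\<close>.\<close>

definition cycle_index :: "nat \<Rightarrow> (nat \<Rightarrow> nat) set \<Rightarrow> ((nat \<Rightarrow> nat) \<Rightarrow> 'a::field_char_0) \<Rightarrow> 'a mseries" where
  "cycle_index d W \<chi> = mscale (1 / of_nat (card W)) (\<Sum>\<sigma>\<in>W. mscale (\<chi> \<sigma>) (cycle_monomial d \<sigma>))"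

definition representation :: "nat \<Rightarrow> nat \<Rightarrow> ((nat \<Rightarrow> nat) \<Rightarrow> 'a::field mat) \<Rightarrow> bool" where
  "representation d n \<rho> \<longleftrightarrow>
     (\<forall>\<sigma>\<in>Sym d. \<rho> \<sigma> \<in> carrier_mat n n) \<and>
     \<rho> id = 1\<^sub>m n \<and>
     (\<forall>\<sigma>\<in>Sym d. \<forall>\<tau>\<in>Sym d. \<rho> (\<sigma> \<circ> \<tau>) = \<rho> \<sigma> * \<rho> \<tau>)"

definition mat_trace :: "'a::comm_monoid_add mat \<Rightarrow> 'a" where
  "mat_trace A = (\<Sum>i<dim_row A. A $$ (i, i))"

text \<open>Functions on $S_d$ are extensional, so that they are determined by their values on $S_d$.\<close>

definition characters :: "nat \<Rightarrow> ((nat \<Rightarrow> nat) \<Rightarrow> 'a::field) set" where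
  "characters d = {(\<lambda>\<sigma>\<in>Sym d. mat_trace (\<rho> \<sigma>)) | \<rho>. \<exists>n. representation d n \<rho>}"

text \<open>The additive group $R^d$ generated by the characters.\<close>

inductive_set generalized_characters :: "nat \<Rightarrow> ((nat \<Rightarrow> nat) \<Rightarrow> 'a::field) set" for d where
  zero: "(\<lambda>\<sigma>\<in>Sym d. 0) \<in> generalized_characters d"
| add: "u \<in> generalized_characters d \<Longrightarrow> \<chi> \<in> characters d \<Longrightarrow>
    (\<lambda>\<sigma>\<in>Sym d. u \<sigma> + \<chi> \<sigma>) \<in> generalized_characters d"
| diff: "u \<in> generalized_characters d \<Longrightarrow> \<chi> \<in> characters d \<Longrightarrow>
    (\<lambda>\<sigma>\<in>Sym d. u \<sigma> - \<chi> \<sigma>) \<in> generalized_characters d"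

definition ch :: "nat \<Rightarrow> ((nat \<Rightarrow> nat) \<Rightarrow> 'a::field_char_0) \<Rightarrow> 'a mseries" where
  "ch d u = mscale (1 / fact d) (\<Sum>\<sigma>\<in>Sym d. mscale (u \<sigma>) (cycle_monomial d \<sigma>))"

text \<open>
  The internal product $ch(u) \ast ch(v) = ch(uv)$ on the image of $R^d$ under the injective
  map \<^const>\<open>ch\<close>, that is, on $\Lambda^d$. Its value at other series is irrelevant.
\<close>

definition internal_prod :: "nat \<Rightarrow> 'a::field_char_0 mseries \<Rightarrow> 'a mseries \<Rightarrow> 'a mseries" where
  "internal_prod d f g =
     (let u = the_inv_into (generalized_characters d) (ch d) f;
          v = the_inv_into (generalized_characters d) (ch d) g
      in ch d (\<lambda>\<sigma>\<in>Sym d. u \<sigma> * v \<sigma>))"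


section \<open>Graphs and superpositions\<close>

text \<open>An edge is an unordered pair of vertices; \<open>Upair i i\<close> is a loop at \<open>i\<close>.\<close>

type_synonym multigraph = "nat uprod multiset"

definition multigraph_on :: "nat \<Rightarrow> multigraph \<Rightarrow> bool" where
  "multigraph_on d \<Gamma> \<longleftrightarrow> (\<forall>e\<in>#\<Gamma>. set_uprod e \<subseteq> {1..d})"

definition aut_group :: "nat \<Rightarrow> multigraph \<Rightarrow> (nat \<Rightarrow> nat) set" where
  "aut_group d \<Gamma> = {\<sigma> \<in> Sym d.
     \<forall>i\<in>{1..d}. \<forall>j\<in>{1..d}. count \<Gamma> (Upair (\<sigma> i) (\<sigma> j)) = count \<Gamma> (Upair i j)}"

definition placements :: "nat \<Rightarrow> nat \<Rightarrow> (nat \<Rightarrow> nat \<Rightarrow> nat) set" where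
  "placements d k = {1..k} \<rightarrow>\<^sub>E Sym d"

definition same_superposition ::
    "nat \<Rightarrow> nat \<Rightarrow> (nat \<Rightarrow> (nat \<Rightarrow> nat) set) \<Rightarrow> ((nat \<Rightarrow> nat \<Rightarrow> nat) \<times> (nat \<Rightarrow> nat \<Rightarrow> nat)) set" where
  "same_superposition d k W = {(a, b). a \<in> placements d k \<and> b \<in> placements d k \<and>
     (\<exists>\<zeta>\<in>Sym d. \<exists>w. \<forall>m\<in>{1..k}. w m \<in> W m \<and> b m = \<zeta> \<circ> a m \<circ> w m)}"

definition superpositions :: "nat \<Rightarrow> nat \<Rightarrow> (nat \<Rightarrow> (nat \<Rightarrow> nat) set) \<Rightarrow> (nat \<Rightarrow> nat \<Rightarrow> nat) set set" where
  "superpositions d k W = placements d k // same_superposition d k W"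

definition superposition_aut ::
    "nat \<Rightarrow> (nat \<Rightarrow> (nat \<Rightarrow> nat) set) \<Rightarrow> (nat \<Rightarrow> nat \<Rightarrow> nat) \<Rightarrow> (nat \<Rightarrow> nat) set" where
  "superposition_aut k W a = (\<Inter>m\<in>{1..k}. {a m \<circ> w \<circ> inv_into UNIV (a m) | w. w \<in> W m})"

text \<open>
  The automorphism groups of two representatives of a superposition are conjugate in $S_d$, so
  one of them consists of even permutations iff the other does.
\<close>

definition even_superposition ::
    "nat \<Rightarrow> (nat \<Rightarrow> (nat \<Rightarrow> nat) set) \<Rightarrow> (nat \<Rightarrow> nat \<Rightarrow> nat) set \<Rightarrow> bool" where
  "even_superposition k W S \<longleftrightarrow> (\<forall>a\<in>S. \<forall>\<sigma>\<in>superposition_aut k W a. evenperm \<sigma>)"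

end

(*
  Let X be the product of the coset spaces S_d / W_m, with S_d acting diagonally. Superpositions are
  the orbits of S_d on X, and automorphism groups of superpositions are the stabilizers. The iterated
  internal product is ch of the character sign * (number of fixed points on X), and the sum of the
  coefficients of ch(u) is the average of u over S_d. Averaging sign * fixed points counts the
  orbits whose stabilizers are contained in the kernel of the sign, because the sum of the sign over a
  stabilizer vanishes unless the stabilizer consists of even permutations.

  That N and the internal product can be evaluated in this way needs the algebraic independence of
  the power sums (compare coefficients at a monomial with the maximal number of variables) and the
  injectivity of ch on generalized characters (permutations of equal cycle type are conjugate).
*)
theory Submission
  imports Defs
begin


section \<open>Algebraic independence of the power sums\<close>

text \<open>Two notions return their intended value only on suitable arguments:
  \<open>power_sum_coeff_sum\<close> selects a polynomial by \<open>THE\<close>, and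
  \<open>internal_prod\<close> inverts \<open>ch\<close> only on
  \<open>generalized_characters d\<close>. Hence each intermediate factor is exhibited as the trace
  of a matrix representation, not merely as a class function. No induced representation has to be
  built for this: the sign lives on all of S_d, so the character induced from its restriction to W_1
  is the sign times the permutation character of S_d / W_1, and permutation matrices scaled by a
  linear character suffice. The final count is made not on X but on the tuples (a_1, ..., a_k),
  moved by pairs (\<zeta>, w) with \<zeta> in S_d and w in the product of the W_m, because
  superpositions are classes of such tuples. A point of X corresponds to |W_1| ... |W_k| tuples;
  this factor is carried along on both sides and cancelled at the end.\<close>

lemma mcoeff_sum: "mcoeff (sum f A) m = (\<Sum>a\<in>A. mcoeff (f a) m)"
  by (induction A rule: infinite_finite_induct)
     (simp_all add: zero_mseries.rep_eq plus_mseries.rep_eq)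

lemma mscale_add: "mscale (a + b) f = mscale a f + mscale b f"
  by (rule mseries_eqI) (simp add: mscale.rep_eq plus_mseries.rep_eq algebra_simps)

lemma mscale_add_right: "mscale a (f + g) = mscale a f + mscale a g"
  by (rule mseries_eqI) (simp add: mscale.rep_eq plus_mseries.rep_eq algebra_simps)

lemma mscale_zero [simp]: "mscale 0 f = 0"
  by (rule mseries_eqI) (simp add: mscale.rep_eq zero_mseries.rep_eq)

lemma mscale_zero_right [simp]: "mscale a 0 = 0"
  by (rule mseries_eqI) (simp add: mscale.rep_eq zero_mseries.rep_eq)

lemma mscale_uminus: "mscale (- a) f = - mscale a f"
  by (rule mseries_eqI) (simp add: mscale.rep_eq uminus_mseries.rep_eq)

lemma mscale_mscale: "mscale a (mscale b f) = mscale (a * b) f"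
  by (rule mseries_eqI) (simp add: mscale.rep_eq mult.assoc)

lemma mscale_sum_right: "mscale a (sum f A) = (\<Sum>x\<in>A. mscale a (f x))"
  by (induction A rule: infinite_finite_induct) (simp_all add: mscale_add_right)

text \<open>The monomials occurring in the product of the p_s for s in the list. Factors may choose
  the same variable, which merges exponents and lowers the number of variables.\<close>

primrec power_product_monomials :: "nat list \<Rightarrow> (nat \<Rightarrow>\<^sub>0 nat) set" where
  "power_product_monomials [] = {0}"
| "power_product_monomials (s # ss) =
    {Poly_Mapping.single i s + b | i b. b \<in> power_product_monomials ss}"

text \<open>The coefficient counts the choices of variables that produce the monomial. Computing it
  in \<open>nat\<close> rules out cancellation between splittings, and characteristic zero keeps a
  positive count nonzero in the field.\<close>

lemma mcoeff_power_product:
  "\<exists>n. mcoeff (prod_list (map power_sum ss) :: 'a::field_char_0 mseries) m = of_nat n \<and>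
       (n > 0 \<longleftrightarrow> m \<in> power_product_monomials ss)"
proof (induction ss arbitrary: m)
  case Nil
  show ?case
    by (rule exI[of _ "if m = 0 then 1 else 0"]) (simp add: one_mseries.rep_eq)
next
  case (Cons s ss)
  from Cons.IH obtain n where
    n: "\<And>b. mcoeff (prod_list (map power_sum ss) :: 'a mseries) b = of_nat (n b)"
    and n0: "\<And>b. n b > 0 \<longleftrightarrow> b \<in> power_product_monomials ss"
    by metis
  define c where "c = (\<lambda>a :: nat \<Rightarrow>\<^sub>0 nat. if \<exists>i. a = Poly_Mapping.single i s then 1 else 0 :: nat)"
  define N where "N = (\<Sum>(a, b)\<in>splittings m. c a * n b)"
  have "mcoeff (prod_list (map power_sum (s # ss)) :: 'a mseries) m = of_nat N"
    by (auto simp: times_mseries.rep_eq power_sum.rep_eq n N_def c_def case_prod_unfold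
        intro!: sum.cong)
  moreover have "N > 0 \<longleftrightarrow> (\<exists>p\<in>splittings m. c (fst p) * n (snd p) > 0)"
    unfolding N_def by (simp add: case_prod_unfold sum_pos2 sum_eq_0_iff flip: neq0_conv)
  moreover have "\<dots> \<longleftrightarrow> m \<in> power_product_monomials (s # ss)"
    by (fastforce simp: c_def splittings_def n0 Bex_def split: if_splits)
  ultimately show ?case
    by blast
qed

lemma mcoeff_power_product_nonzero_iff:
  "mcoeff (prod_list (map power_sum ss) :: 'a::field_char_0 mseries) m \<noteq> 0
    \<longleftrightarrow> m \<in> power_product_monomials ss"
  using mcoeff_power_product[of ss m, where 'a = 'a] by auto

lemma keys_add_nat:
  "Poly_Mapping.keys (a + b :: 'b \<Rightarrow>\<^sub>0 nat) = Poly_Mapping.keys a \<union> Poly_Mapping.keys b"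
  by (auto simp: in_keys_iff lookup_add)

lemma power_product_monomials_card_keys:
  assumes "m \<in> power_product_monomials ss"
  shows "card (Poly_Mapping.keys m) \<le> length ss"
  using assms
proof (induction ss arbitrary: m)
  case (Cons s ss)
  then obtain i b where m: "m = Poly_Mapping.single i s + b" and b: "b \<in> power_product_monomials ss"
    by auto
  have "card (Poly_Mapping.keys m) \<le> card (insert i (Poly_Mapping.keys b))"
    unfolding m by (rule card_mono) (auto simp: keys_add_nat)
  also have "\<dots> \<le> Suc (card (Poly_Mapping.keys b))"
    by (simp add: card_insert_if)
  finally show ?case
    using Cons.IH[OF b] by simp
qed simp

text \<open>
  With the maximal number of variables, the factors of a monomial of $p_{s_1} p_{s_2} \cdots$ use
  different variables, so the exponents give back the factors.
\<close>

lemma power_product_monomials_exponents: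
  assumes "m \<in> power_product_monomials ss" and "card (Poly_Mapping.keys m) = length ss"
  shows "image_mset (Poly_Mapping.lookup m) (mset_set (Poly_Mapping.keys m)) = mset ss"
  using assms
proof (induction ss arbitrary: m)
  case (Cons s ss)
  then obtain i b where m: "m = Poly_Mapping.single i s + b" and b: "b \<in> power_product_monomials ss"
    by auto
  have keys: "Poly_Mapping.keys m = (if s = 0 then {} else {i}) \<union> Poly_Mapping.keys b"
    by (simp add: m keys_add_nat)
  have le: "card (Poly_Mapping.keys b) \<le> length ss"
    by (rule power_product_monomials_card_keys[OF b])
  \<comment> \<open>Equality in the bound excludes both ways of losing a variable: s = 0, and i
    already occurring in b.\<close>
  have s: "s \<noteq> 0" and i: "i \<notin> Poly_Mapping.keys b" and card: "card (Poly_Mapping.keys b) = length ss"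
    using Cons.prems(2) le by (auto simp: keys card_insert_if split: if_splits)
  have "Poly_Mapping.lookup m i = s"
    using i by (simp add: m lookup_add in_keys_iff)
  moreover have "image_mset (Poly_Mapping.lookup m) (mset_set (Poly_Mapping.keys b))
      = image_mset (Poly_Mapping.lookup b) (mset_set (Poly_Mapping.keys b))"
    using i by (intro image_mset_cong) (auto simp: m lookup_add lookup_single when_def)
  ultimately show ?case
    using Cons.IH[OF b card] s i by (simp add: keys)
qed simp

text \<open>A fresh variable is taken for each factor. Zero is excluded because
  \<open>Poly_Mapping.single i 0\<close> is the empty monomial and adds no variable.\<close>

lemma power_product_monomials_full:
  assumes "0 \<notin> set ss"
  shows "\<exists>m\<in>power_product_monomials ss. card (Poly_Mapping.keys m) = length ss"
  using assms
proof (induction ss)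
  case (Cons s ss)
  then obtain b where b: "b \<in> power_product_monomials ss" "card (Poly_Mapping.keys b) = length ss"
    by auto
  obtain i where i: "i \<notin> Poly_Mapping.keys b"
    using ex_new_if_finite[OF infinite_UNIV_nat finite_keys] by blast
  show ?case
    using b i Cons.prems
    by (intro bexI[of _ "Poly_Mapping.single i s + b"]) (auto simp: keys_add_nat)
qed simp

text \<open>The partition with e_s parts equal to s; it turns exponent vectors into the lists of
  factors for which the support is described.\<close>

definition exponent_mset :: "nat \<Rightarrow> (nat \<Rightarrow>\<^sub>0 nat) \<Rightarrow> nat multiset" where
  "exponent_mset d e = (\<Sum>s=1..d. replicate_mset (Poly_Mapping.lookup e s) s)"

lemma count_exponent_mset:
  "count (exponent_mset d e) s = (if s \<in> {1..d} then Poly_Mapping.lookup e s else 0)"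
  by (simp add: exponent_mset_def count_sum sum.delta')

lemma prod_power_sum_eq_prod_mset:
  "(\<Prod>s=1..d. power_sum s ^ Poly_Mapping.lookup e s)
    = prod_mset (image_mset power_sum (exponent_mset d e))"
proof -
  have "prod_mset (image_mset power_sum (\<Sum>s\<in>S. replicate_mset (Poly_Mapping.lookup e s) s))
      = (\<Prod>s\<in>S. power_sum s ^ Poly_Mapping.lookup e s :: 'a mseries)" if "finite S" for S
    using that by induction simp_all
  then show ?thesis
    by (simp add: exponent_mset_def)
qed

lemma exponent_mset_inject:
  assumes "Poly_Mapping.keys e \<subseteq> {1..d}" "Poly_Mapping.keys e' \<subseteq> {1..d}"
    and "exponent_mset d e = exponent_mset d e'"
  shows "e = e'"
proof (rule poly_mapping_eqI)
  fix s
  have "count (exponent_mset d e) s = count (exponent_mset d e') s"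
    using assms by simp
  then show "Poly_Mapping.lookup e s = Poly_Mapping.lookup e' s"
    using subsetD[OF assms(1), of s] subsetD[OF assms(2), of s]
    unfolding count_exponent_mset in_keys_iff by metis
qed

text \<open>Take a term of A with the largest number of factors and a monomial m of it with as many
  variables as factors. A term with fewer factors cannot reach that many variables, and one with
  equally many must have the same exponents. So the coefficient at m is a nonzero multiple of one
  coefficient of A.\<close>

lemma subst_power_sums_eq_0:
  fixes A :: "(nat \<Rightarrow>\<^sub>0 nat) \<Rightarrow>\<^sub>0 'a::field_char_0"
  assumes A: "A \<in> polys d" and zero: "subst_power_sums d A = 0"
  shows "A = 0"
proof (rule ccontr)
  assume "A \<noteq> 0"
  then have "Poly_Mapping.keys A \<noteq> {}"
    by simp
  then obtain e where e: "e \<in> Poly_Mapping.keys A"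
    and max: "\<And>e'. e' \<in> Poly_Mapping.keys A \<Longrightarrow> size (exponent_mset d e') \<le> size (exponent_mset d e)"
    using obtains_MAX[of "Poly_Mapping.keys A" "\<lambda>e. size (exponent_mset d e)"]
    by (metis Max_ge finite_imageI finite_keys imageI)
  define ss where "ss e = sorted_list_of_multiset (exponent_mset d e)" for e
  have ss: "mset (ss e) = exponent_mset d e" for e
    by (simp add: ss_def)
  have coeff: "mcoeff (\<Prod>s=1..d. power_sum s ^ Poly_Mapping.lookup e' s :: 'a mseries) m \<noteq> 0
      \<longleftrightarrow> m \<in> power_product_monomials (ss e')" for e' m
    unfolding prod_power_sum_eq_prod_mset ss[symmetric] mset_map[symmetric] prod_mset_prod_list
    by (rule mcoeff_power_product_nonzero_iff)
  have "0 \<notin># exponent_mset d e"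
    by (simp add: count_exponent_mset flip: count_eq_zero_iff)
  then have "0 \<notin> set (ss e)"
    by (simp flip: ss)
  then obtain m where m: "m \<in> power_product_monomials (ss e)"
      "card (Poly_Mapping.keys m) = length (ss e)"
    using power_product_monomials_full by blast
  have len: "length (ss e') = size (exponent_mset d e')" for e'
    by (simp flip: ss)
  have other: "mcoeff (\<Prod>s=1..d. power_sum s ^ Poly_Mapping.lookup e' s :: 'a mseries) m = 0"
    if e': "e' \<in> Poly_Mapping.keys A" "e' \<noteq> e" for e'
  proof (rule ccontr)
    assume "\<not> ?thesis"
    then have m': "m \<in> power_product_monomials (ss e')"
      unfolding coeff by simp
    \<comment> \<open>A squeeze: the length of \<open>ss e'\<close> is at least the number of
      variables of m and, by maximality of e, at most the length of \<open>ss e\<close>, which is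
      that number.\<close>
    then have "card (Poly_Mapping.keys m) = length (ss e')"
      using power_product_monomials_card_keys[OF m'] max[OF e'(1)] m(2) by (simp add: len)
    then have "mset (ss e') = mset (ss e)"
      using power_product_monomials_exponents m m' by metis
    then show False
      using exponent_mset_inject[of e' d e] A e e' by (auto simp: ss polys_def)
  qed
  have "0 = mcoeff (subst_power_sums d A) m"
    by (simp add: zero zero_mseries.rep_eq)
  also have "\<dots> = (\<Sum>e'\<in>Poly_Mapping.keys A. Poly_Mapping.lookup A e' *
      mcoeff (\<Prod>s=1..d. power_sum s ^ Poly_Mapping.lookup e' s) m)"
    by (simp add: subst_power_sums_def mcoeff_sum mscale.rep_eq)
  also have "\<dots> = (\<Sum>e'\<in>{e}. Poly_Mapping.lookup A e' *
      mcoeff (\<Prod>s=1..d. power_sum s ^ Poly_Mapping.lookup e' s) m)"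
    using e other by (intro sum.mono_neutral_right) auto
  finally show False
    using coeff[of e m] m(1) e by (simp add: in_keys_iff)
qed

section \<open>Evaluation of N by linearity\<close>

lemma subst_power_sums_add:
  "subst_power_sums d (A + B) = subst_power_sums d A + subst_power_sums d B"
  unfolding subst_power_sums_def
  by (rule setsum_keys_plus_distrib[where f = "\<lambda>e c. mscale c (\<Prod>s=1..d. power_sum s ^ Poly_Mapping.lookup e s)"])
     (simp_all add: mscale_add)

lemma subst_power_sums_uminus: "subst_power_sums d (- A) = - subst_power_sums d A"
  by (simp add: subst_power_sums_def mscale_uminus sum_negf)

lemma subst_power_sums_single:
  "subst_power_sums d (Poly_Mapping.single e c) = mscale c (\<Prod>s=1..d. power_sum s ^ Poly_Mapping.lookup e s)"
  by (simp add: subst_power_sums_def)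

lemma subst_power_sums_sum: "subst_power_sums d (sum f S) = (\<Sum>x\<in>S. subst_power_sums d (f x))"
  by (induction S rule: infinite_finite_induct) (simp_all add: subst_power_sums_add, simp_all add: subst_power_sums_def)

lemma coeff_sum_add: "coeff_sum (A + B) = coeff_sum A + coeff_sum B"
  unfolding coeff_sum_def by (rule setsum_keys_plus_distrib[where f = "\<lambda>e c. c"]) simp_all

lemma coeff_sum_single: "coeff_sum (Poly_Mapping.single e c) = c"
  by (simp add: coeff_sum_def)

lemma coeff_sum_sum: "coeff_sum (sum f S) = (\<Sum>x\<in>S. coeff_sum (f x))"
  by (induction S rule: infinite_finite_induct) (simp_all add: coeff_sum_add, simp_all add: coeff_sum_def)

lemma polys_diff:
  fixes A :: "(nat \<Rightarrow>\<^sub>0 nat) \<Rightarrow>\<^sub>0 'a::ab_group_add"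
  shows "A \<in> polys d \<Longrightarrow> B \<in> polys d \<Longrightarrow> A - B \<in> polys d"
  unfolding polys_def using keys_diff[of A B] by blast

text \<open>Algebraic independence supplies the uniqueness that the \<open>THE\<close> in
  \<open>power_sum_coeff_sum\<close> requires.\<close>

lemma power_sum_coeff_sum_subst:
  fixes A :: "(nat \<Rightarrow>\<^sub>0 nat) \<Rightarrow>\<^sub>0 'a::field_char_0"
  assumes "A \<in> polys d"
  shows "power_sum_coeff_sum d (subst_power_sums d A) = coeff_sum A"
proof -
  have "B = A" if B: "B \<in> polys d" "subst_power_sums d B = subst_power_sums d A" for B
  proof -
    have "subst_power_sums d (B - A) = 0"
      using subst_power_sums_add[of d B "- A"] B(2) by (simp add: subst_power_sums_uminus)
    then show ?thesis
      using subst_power_sums_eq_0[OF polys_diff[OF B(1) assms]] by simp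
  qed
  then have "(THE B. B \<in> polys d \<and> subst_power_sums d B = subst_power_sums d A) = A"
    using assms by blast
  then show ?thesis
    by (simp add: power_sum_coeff_sum_def)
qed

section \<open>The characteristic map\<close>

lift_definition cycle_exponents :: "nat \<Rightarrow> (nat \<Rightarrow> nat) \<Rightarrow> (nat \<Rightarrow>\<^sub>0 nat)"
  is "\<lambda>d \<sigma> s. if s \<in> {1..d} then num_cycles d s \<sigma> else 0"
  by (rule finite_subset[of _ "{1..d}" for d]) auto

text \<open>This is \<open>ch d u\<close> before the power sums are substituted. Permutations of one
  cycle type share an index, so their values are added up there.\<close>

definition cycle_poly :: "nat \<Rightarrow> ((nat \<Rightarrow> nat) \<Rightarrow> 'a::field_char_0) \<Rightarrow> ((nat \<Rightarrow>\<^sub>0 nat) \<Rightarrow>\<^sub>0 'a)" where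
  "cycle_poly d u = (\<Sum>\<sigma>\<in>Sym d. Poly_Mapping.single (cycle_exponents d \<sigma>) (u \<sigma> / fact d))"

lemma ch_eq_subst_cycle_poly: "ch d u = subst_power_sums d (cycle_poly d u)"
proof -
  have "subst_power_sums d (Poly_Mapping.single (cycle_exponents d \<sigma>) (u \<sigma> / fact d))
      = mscale (1 / fact d) (mscale (u \<sigma>) (cycle_monomial d \<sigma>))" for \<sigma>
    by (simp add: subst_power_sums_single mscale_mscale cycle_monomial_def cycle_exponents.rep_eq)
  then show ?thesis
    by (simp add: ch_def cycle_poly_def subst_power_sums_sum mscale_sum_right)
qed

lemma cycle_poly_in_polys: "cycle_poly d u \<in> polys d"
proof -
  have "Poly_Mapping.keys (cycle_exponents d \<sigma>) \<subseteq> {1..d}" for \<sigma>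
    by (auto simp: in_keys_iff cycle_exponents.rep_eq split: if_splits)
  moreover have "Poly_Mapping.keys (cycle_poly d u) \<subseteq> cycle_exponents d ` Sym d"
    unfolding cycle_poly_def by (rule order.trans[OF keys_sum]) auto
  ultimately show ?thesis
    unfolding polys_def by blast
qed

text \<open>Each permutation contributes one monomial in the p_s, and N forgets which one.\<close>

lemma power_sum_coeff_sum_ch: "power_sum_coeff_sum d (ch d u) = (\<Sum>\<sigma>\<in>Sym d. u \<sigma>) / fact d"
  unfolding ch_eq_subst_cycle_poly power_sum_coeff_sum_subst[OF cycle_poly_in_polys]
  by (simp add: cycle_poly_def coeff_sum_sum coeff_sum_single sum_divide_distrib)


section \<open>Cycle types and conjugacy\<close>

text \<open>The first return time n of x is the size of its orbit: the iterates below n are distinct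
  and exhaust the orbit, and the n-th is x again.\<close>

lemma funpow_eq_iff_mod_card_orbit:
  assumes "permutation f"
  shows "(f ^^ i) x = (f ^^ j) x \<longleftrightarrow> i mod card (orbit f x) = j mod card (orbit f x)"
proof -
  define n where "n = funpow_dist1 f x x"
  have self: "x \<in> orbit f x"
    by (rule permutation_self_in_orbit[OF assms])
  have inj: "inj_on (\<lambda>k. (f ^^ k) x) {0..<n}"
    unfolding n_def by (rule inj_on_funpow_dist1[OF self])
  have "orbit f x = (\<lambda>k. (f ^^ k) x) ` {0..<n}"
    unfolding n_def by (rule orbit_conv_funpow_dist1[OF self])
  then have card: "card (orbit f x) = n"
    using card_image[OF inj] by simp
  have "(f ^^ n) x = x"
    unfolding n_def by (rule funpow_dist1_prop[OF self])
  then have mod: "(f ^^ k) x = (f ^^ (k mod n)) x" for k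
    by (simp add: funpow_mod_eq)
  have "n > 0"
    by (simp add: n_def)
  then show ?thesis
    using inj_onD[OF inj, of "i mod n" "j mod n"] mod[of i] mod[of j] by (auto simp: card)
qed

text \<open>Bijections between the members of each size are glued; they cannot collide because each
  preserves the size.\<close>

lemma ex_card_preserving_bij:
  assumes "finite A" "finite B"
    and "\<And>s. card {C \<in> A. card C = s} = card {C \<in> B. card C = s}"
  shows "\<exists>h. bij_betw h A B \<and> (\<forall>C\<in>A. card (h C) = card C)"
proof -
  have "\<exists>g. bij_betw g {C \<in> A. card C = s} {C \<in> B. card C = s}" for s
    using assms by (intro finite_same_card_bij) auto
  then obtain g where g: "\<And>s. bij_betw (g s) {C \<in> A. card C = s} {C \<in> B. card C = s}"
    by metis
  define h where "h = (\<lambda>C. g (card C) C)"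
  have h: "h C \<in> B \<and> card (h C) = card C" if "C \<in> A" for C
    using bij_betwE[OF g[of "card C"]] that by (auto simp: h_def)
  have "inj_on h A"
  proof (rule inj_onI)
    fix C C' assume C: "C \<in> A" "C' \<in> A" "h C = h C'"
    then have "card C = card C'"
      using h by metis
    then show "C = C'"
      using C inj_onD[OF bij_betw_imp_inj_on[OF g[of "card C"]], of C C'] by (simp add: h_def)
  qed
  moreover have "B \<subseteq> h ` A"
  proof
    fix D assume "D \<in> B"
    then have "D \<in> g (card D) ` {C \<in> A. card C = card D}"
      unfolding bij_betw_imp_surj_on[OF g] by simp
    then obtain C where "C \<in> A" "card C = card D" "g (card D) C = D"
      by fastforce
    then have "D = h C"
      by (simp add: h_def)
    then show "D \<in> h ` A"
      using \<open>C \<in> A\<close> by (rule image_eqI)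
  qed
  ultimately show ?thesis
    using h unfolding bij_betw_def by blast
qed

text \<open>Pair the cycles of \<sigma> with cycles of \<tau> of the same length, choose base points
  c and b in partner cycles, and send the i-th \<sigma>-iterate of c to the i-th \<tau>-iterate of
  b. Equal lengths make this independent of the exponent.\<close>

lemma same_num_cycles_imp_conjugate:
  assumes \<sigma>: "\<sigma> \<in> Sym d" and \<tau>: "\<tau> \<in> Sym d"
    and cycles: "\<And>s. s \<in> {1..d} \<Longrightarrow> num_cycles d s \<sigma> = num_cycles d s \<tau>"
  shows "\<exists>\<phi>\<in>Sym d. \<phi> \<circ> \<sigma> = \<tau> \<circ> \<phi>"
proof -
  have perm: "permutation \<sigma>" "permutation \<tau>"
    using \<sigma> \<tau> by (auto simp: permutation_permutes)
  have range: "card (orbit f x) \<in> {1..d}" if "f \<in> Sym d" "x \<in> {1..d}" for f x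
  proof -
    have sub: "orbit f x \<subseteq> {1..d}"
      using that permutes_orbit_subset[of f "{1..d}" x] by simp
    then have "card (orbit f x) \<noteq> 0"
      using orbit_nonempty[of f x] finite_subset[OF sub] by simp
    moreover have "card (orbit f x) \<le> d"
      using card_mono[OF _ sub] by simp
    ultimately show ?thesis
      by simp
  qed
  \<comment> \<open>Lengths outside \<open>{1..d}\<close> are not covered by \<open>cycles\<close>,
    but no orbit has such a size.\<close>
  have "card {C \<in> orbit \<sigma> ` {1..d}. card C = s} = card {C \<in> orbit \<tau> ` {1..d}. card C = s}" for s
  proof (cases "s \<in> {1..d}")
    case True
    then show ?thesis
      using cycles by (simp add: num_cycles_def)
  next
    case False
    then have "{C \<in> orbit \<sigma> ` {1..d}. card C = s} = {}" "{C \<in> orbit \<tau> ` {1..d}. card C = s} = {}"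
      using range \<sigma> \<tau> by blast+
    then show ?thesis
      by (simp only:)
  qed
  then have "\<exists>h. bij_betw h (orbit \<sigma> ` {1..d}) (orbit \<tau> ` {1..d}) \<and>
      (\<forall>C\<in>orbit \<sigma> ` {1..d}. card (h C) = card C)"
    by (intro ex_card_preserving_bij finite_imageI finite_atLeastAtMost)
  then obtain h where h: "bij_betw h (orbit \<sigma> ` {1..d}) (orbit \<tau> ` {1..d})"
    and card_h: "\<And>C. C \<in> orbit \<sigma> ` {1..d} \<Longrightarrow> card (h C) = card C"
    by blast
  have "\<exists>x. x \<in> {1..d} \<and> C = orbit \<sigma> x" if "C \<in> orbit \<sigma> ` {1..d}" for C
    using that by blast
  then obtain c where c: "\<And>C. C \<in> orbit \<sigma> ` {1..d} \<Longrightarrow> c C \<in> {1..d} \<and> C = orbit \<sigma> (c C)"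
    by metis
  have "\<exists>x. x \<in> {1..d} \<and> h C = orbit \<tau> x" if "C \<in> orbit \<sigma> ` {1..d}" for C
    using bij_betwE[OF h] that by blast
  then obtain b where b: "\<And>C. C \<in> orbit \<sigma> ` {1..d} \<Longrightarrow> b C \<in> {1..d} \<and> h C = orbit \<tau> (b C)"
    by metis
  have "\<exists>i. x = (\<sigma> ^^ i) (c (orbit \<sigma> x))" if "x \<in> {1..d}" for x
    using permutation_self_in_orbit[OF perm(1), of x] c[of "orbit \<sigma> x"] that
      orbit_altdef_permutation[OF perm(1), of "c (orbit \<sigma> x)"] by blast
  then obtain i where i: "\<And>x. x \<in> {1..d} \<Longrightarrow> x = (\<sigma> ^^ i x) (c (orbit \<sigma> x))"
    by metis
  \<comment> \<open>Both sequences of iterates have the common cycle length as period. Left to right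
    makes \<phi> well defined, right to left makes it injective.\<close>
  have same: "(\<sigma> ^^ p) (c C) = (\<sigma> ^^ q) (c C) \<longleftrightarrow> (\<tau> ^^ p) (b C) = (\<tau> ^^ q) (b C)"
    if "C \<in> orbit \<sigma> ` {1..d}" for C p q
    using c[OF that] b[OF that] card_h[OF that]
    by (simp add: funpow_eq_iff_mod_card_orbit perm)
  define \<phi> where "\<phi> = (\<lambda>x. if x \<in> {1..d} then (\<tau> ^^ i x) (b (orbit \<sigma> x)) else x)"
  have \<phi>_eq: "\<phi> x = (\<tau> ^^ p) (b (orbit \<sigma> x))"
    if "x \<in> {1..d}" "x = (\<sigma> ^^ p) (c (orbit \<sigma> x))" for x p
    using that i[OF that(1)] same[of "orbit \<sigma> x" p "i x"] by (auto simp: \<phi>_def)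
  have orbit_\<phi>: "orbit \<tau> (\<phi> x) = h (orbit \<sigma> x)" if "x \<in> {1..d}" for x
  proof -
    have "\<phi> x \<in> orbit \<tau> (b (orbit \<sigma> x))"
      using that orbit_altdef_permutation[OF perm(2), of "b (orbit \<sigma> x)"] by (auto simp: \<phi>_def)
    then show ?thesis
      using b[of "orbit \<sigma> x"] that cyclic_on_orbit'[OF perm(2)] orbit_cyclic_eq3 by (metis imageI)
  qed
  have \<phi>_in: "\<phi> x \<in> {1..d}" if "x \<in> {1..d}" for x
  proof -
    have "\<phi> x \<in> orbit \<tau> (b (orbit \<sigma> x))"
      using permutation_self_in_orbit[OF perm(2), of "\<phi> x"] orbit_\<phi>[OF that] b[of "orbit \<sigma> x"] that
      by simp
    then show ?thesis
      using permutes_orbit_subset[of \<tau> "{1..d}" "b (orbit \<sigma> x)"] \<tau> b[of "orbit \<sigma> x"] that by auto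
  qed
  have inj: "inj_on \<phi> {1..d}"
  proof (rule inj_onI)
    fix x y assume xy: "x \<in> {1..d}" "y \<in> {1..d}" "\<phi> x = \<phi> y"
    then have "h (orbit \<sigma> x) = h (orbit \<sigma> y)"
      using orbit_\<phi> by metis
    then have orb: "orbit \<sigma> x = orbit \<sigma> y"
      using bij_betw_imp_inj_on[OF h] xy by (auto dest: inj_onD)
    have "(\<tau> ^^ i x) (b (orbit \<sigma> x)) = (\<tau> ^^ i y) (b (orbit \<sigma> x))"
      using xy by (simp add: \<phi>_def orb)
    then show "x = y"
      using i[OF xy(1)] i[OF xy(2)] same[OF imageI[OF xy(1)], of "i x" "i y"] orb by metis
  qed
  have "\<phi> ` {1..d} \<subseteq> {1..d}"
    using \<phi>_in by (rule image_subsetI)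
  then have "bij_betw \<phi> {1..d} {1..d}"
    using endo_inj_surj[OF finite_atLeastAtMost _ inj] inj unfolding bij_betw_def by blast
  then have "\<phi> permutes {1..d}"
    by (rule bij_imp_permutes) (simp only: \<phi>_def if_False)
  then have "\<phi> \<in> Sym d"
    by simp
  moreover have "\<phi> (\<sigma> x) = \<tau> (\<phi> x)" for x
  proof (cases "x \<in> {1..d}")
    case True
    then have in': "\<sigma> x \<in> {1..d}"
      using \<sigma> by (simp add: permutes_in_image del: atLeastAtMost_iff)
    have orb: "orbit \<sigma> (\<sigma> x) = orbit \<sigma> x"
      by (rule permutation_orbit_step[OF perm(1)])
    \<comment> \<open>\<open>Suc (i x)\<close> need not be the exponent chosen for \<sigma> x, but
      the value of \<phi> does not depend on that choice.\<close>
    have "\<sigma> x = (\<sigma> ^^ Suc (i x)) (c (orbit \<sigma> (\<sigma> x)))"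
      using i[OF True] by (simp add: orb)
    from \<phi>_eq[OF in' this] show ?thesis
      using True by (simp add: \<phi>_def orb)
  next
    case False
    then have "\<sigma> x = x" "\<tau> x = x"
      using \<sigma> \<tau> by (simp_all add: permutes_not_in)
    moreover have "\<phi> x = x"
      using False by (simp only: \<phi>_def if_False)
    ultimately show ?thesis
      by simp
  qed
  ultimately show ?thesis
    by (auto simp: fun_eq_iff)
qed

text \<open>The map \<phi> carries the cycles of \<sigma> to those of \<tau> and keeps their sizes.
  This makes cycle monomials class functions.\<close>

lemma num_cycles_conjugate:
  assumes "\<phi> \<in> Sym d" "\<sigma> \<in> Sym d" and conj: "\<phi> \<circ> \<sigma> = \<tau> \<circ> \<phi>"
  shows "num_cycles d s \<tau> = num_cycles d s \<sigma>"
proof -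
  have perm: "permutation \<sigma>"
    using assms(2) by (auto simp: permutation_permutes)
  have inj: "inj \<phi>"
    using assms(1) by (simp add: permutes_inj)
  have orb: "orbit \<tau> (\<phi> x) = \<phi> ` orbit \<sigma> x" for x
    using orbit_inverse[OF permutation_self_in_orbit[OF perm], of x \<tau> \<phi>] conj
    by (simp add: fun_eq_iff)
  have "orbit \<tau> ` {1..d} = orbit \<tau> ` \<phi> ` {1..d}"
    using assms(1) by (simp add: permutes_image)
  also have "\<dots> = (`) \<phi> ` orbit \<sigma> ` {1..d}"
    by (simp add: image_image orb)
  finally have "{C \<in> orbit \<tau> ` {1..d}. card C = s} = (`) \<phi> ` {C \<in> orbit \<sigma> ` {1..d}. card C = s}"
    using inj by (auto simp: card_image inj_on_subset)
  then show ?thesis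
    using inj by (simp add: num_cycles_def card_image inj_on_image inj_on_def inj_image_eq_iff)
qed

section \<open>Class functions and injectivity of the characteristic map\<close>

lemma trace_mult_commute:
  fixes A B :: "'a::comm_ring_1 mat"
  assumes "A \<in> carrier_mat n n" "B \<in> carrier_mat n n"
  shows "mat_trace (A * B) = mat_trace (B * A)"
proof -
  have "mat_trace (A * B) = (\<Sum>i<n. \<Sum>j<n. A $$ (i, j) * B $$ (j, i))"
    using assms by (simp add: mat_trace_def scalar_prod_def atLeast0LessThan)
  also have "\<dots> = (\<Sum>j<n. \<Sum>i<n. B $$ (j, i) * A $$ (i, j))"
    by (subst sum.swap) (simp add: mult.commute)
  also have "\<dots> = mat_trace (B * A)"
    using assms by (simp add: mat_trace_def scalar_prod_def atLeast0LessThan)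
  finally show ?thesis .
qed

text \<open>Since \<tau> is the product of \<phi> and \<sigma> \<phi>^-1, exchanging the two
  corresponding matrices under the trace gives the value at \<sigma>.\<close>

lemma character_conjugate:
  assumes "\<chi> \<in> characters d" "\<phi> \<in> Sym d" "\<sigma> \<in> Sym d" "\<tau> \<in> Sym d" and conj: "\<phi> \<circ> \<sigma> = \<tau> \<circ> \<phi>"
  shows "\<chi> \<tau> = \<chi> \<sigma>"
proof -
  obtain \<rho> n where \<chi>: "\<chi> = (\<lambda>\<sigma>\<in>Sym d. mat_trace (\<rho> \<sigma>))" and \<rho>: "representation d n \<rho>"
    using assms(1) by (auto simp: characters_def)
  have inv: "inv_into UNIV \<phi> \<in> Sym d"
    using assms(2) by (simp add: permutes_inv)
  have in': "\<sigma> \<circ> inv_into UNIV \<phi> \<in> Sym d"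
    using inv assms(3) by (simp add: permutes_compose)
  have "\<phi> \<circ> inv_into UNIV \<phi> = id" and inv_\<phi>: "inv_into UNIV \<phi> \<circ> \<phi> = id"
    using assms(2) by (simp_all add: permutes_inv_o)
  then have "\<tau> = \<phi> \<circ> (\<sigma> \<circ> inv_into UNIV \<phi>)"
    by (metis comp_assoc comp_id conj)
  then have "mat_trace (\<rho> \<tau>) = mat_trace (\<rho> \<phi> * \<rho> (\<sigma> \<circ> inv_into UNIV \<phi>))"
    using \<rho> assms(2) in' by (simp add: representation_def)
  also have "\<dots> = mat_trace (\<rho> (\<sigma> \<circ> inv_into UNIV \<phi>) * \<rho> \<phi>)"
    using \<rho> assms(2) in' by (intro trace_mult_commute[of _ n]) (simp_all add: representation_def)
  also have "\<rho> (\<sigma> \<circ> inv_into UNIV \<phi>) * \<rho> \<phi> = \<rho> (\<sigma> \<circ> inv_into UNIV \<phi> \<circ> \<phi>)"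
    using \<rho> assms(2) in' by (simp add: representation_def)
  also have "\<sigma> \<circ> inv_into UNIV \<phi> \<circ> \<phi> = \<sigma>"
    by (simp add: comp_assoc inv_\<phi>)
  finally show ?thesis
    using assms(3,4) by (simp add: \<chi>)
qed

lemma generalized_character_conjugate:
  assumes "u \<in> generalized_characters d"
    and "\<phi> \<in> Sym d" "\<sigma> \<in> Sym d" "\<tau> \<in> Sym d" "\<phi> \<circ> \<sigma> = \<tau> \<circ> \<phi>"
  shows "u \<tau> = u \<sigma>"
  using assms by induction (auto simp: character_conjugate[OF _ assms(2-5)])

lemma generalized_character_extensional:
  "u \<in> generalized_characters d \<Longrightarrow> u \<in> extensional (Sym d)"
  by (induction rule: generalized_characters.induct) (simp_all only: restrict_extensional)

text \<open>By algebraic independence, equal images under \<open>ch\<close> come from equal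
  polynomials. The coefficient at a cycle type is the class size times the common value over d!, so
  the values can be read off.\<close>

lemma inj_on_ch: "inj_on (ch d) (generalized_characters d :: ((nat \<Rightarrow> nat) \<Rightarrow> 'a::field_char_0) set)"
proof (rule inj_onI)
  fix u v :: "(nat \<Rightarrow> nat) \<Rightarrow> 'a"
  assume u: "u \<in> generalized_characters d" and v: "v \<in> generalized_characters d"
    and eq: "ch d u = ch d v"
  let ?A = "cycle_poly d u" and ?B = "cycle_poly d v"
  have "subst_power_sums d (?A - ?B) = 0"
    using eq subst_power_sums_add[of d ?A "- ?B"]
    by (simp add: ch_eq_subst_cycle_poly subst_power_sums_uminus)
  then have "?A = ?B"
    using subst_power_sums_eq_0[OF polys_diff[OF cycle_poly_in_polys cycle_poly_in_polys], of d u v]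
    by simp
  moreover have "Poly_Mapping.lookup (cycle_poly d w) (cycle_exponents d \<tau>)
      = of_nat (card {\<sigma> \<in> Sym d. cycle_exponents d \<sigma> = cycle_exponents d \<tau>}) * (w \<tau> / fact d)"
    if w: "w \<in> generalized_characters d" and \<tau>: "\<tau> \<in> Sym d" for w :: "(nat \<Rightarrow> nat) \<Rightarrow> 'a" and \<tau>
  proof -
    have const: "w \<sigma> = w \<tau>" if \<sigma>: "\<sigma> \<in> Sym d" "cycle_exponents d \<sigma> = cycle_exponents d \<tau>" for \<sigma>
    proof -
      have "num_cycles d s \<sigma> = num_cycles d s \<tau>" if "s \<in> {1..d}" for s
        using arg_cong[OF \<sigma>(2), of "\<lambda>e. Poly_Mapping.lookup e s"] that
        by (simp add: cycle_exponents.rep_eq)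
      from same_num_cycles_imp_conjugate[OF \<sigma>(1) \<tau> this] show ?thesis
        using generalized_character_conjugate[OF w _ \<sigma>(1) \<tau>] by metis
    qed
    have "Poly_Mapping.lookup (cycle_poly d w) (cycle_exponents d \<tau>)
        = (\<Sum>\<sigma>\<in>Sym d. if cycle_exponents d \<sigma> = cycle_exponents d \<tau> then w \<sigma> / fact d else 0)"
      by (simp add: cycle_poly_def lookup_sum lookup_single when_def)
    also have "\<dots> = (\<Sum>\<sigma>\<in>{\<sigma> \<in> Sym d. cycle_exponents d \<sigma> = cycle_exponents d \<tau>}. w \<sigma> / fact d)"
      by (subst sum.inter_filter[symmetric]) (auto simp: finite_permutations intro!: sum.cong)
    also have "\<dots> = (\<Sum>\<sigma>\<in>{\<sigma> \<in> Sym d. cycle_exponents d \<sigma> = cycle_exponents d \<tau>}. w \<tau> / fact d)"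
      using const by (intro sum.cong) auto
    finally show ?thesis
      by simp
  qed
  \<comment> \<open>The class contains \<tau> itself, so in characteristic zero its size can be
    cancelled.\<close>
  moreover have "card {\<sigma> \<in> Sym d. cycle_exponents d \<sigma> = cycle_exponents d \<tau>} \<noteq> 0"
    if "\<tau> \<in> Sym d" for \<tau>
    using that by (auto simp: card_eq_0_iff finite_permutations)
  ultimately have "u \<tau> = v \<tau>" if "\<tau> \<in> Sym d" for \<tau>
    using u v that by (metis (no_types, lifting) divide_cancel_right fact_nonzero mult_cancel_left of_nat_eq_0_iff)
  then show "u = v"
    using generalized_character_extensional[OF u] generalized_character_extensional[OF v]
    by (rule_tac extensionalityI)
qed

lemma the_inv_ch:
  "u \<in> generalized_characters d \<Longrightarrow> the_inv_into (generalized_characters d) (ch d) (ch d u) = u"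
  by (rule the_inv_into_f_f[OF inj_on_ch])

lemma internal_prod_ch:
  assumes "u \<in> generalized_characters d" "v \<in> generalized_characters d"
  shows "internal_prod d (ch d u) (ch d v) = ch d (\<lambda>\<sigma>\<in>Sym d. u \<sigma> * v \<sigma>)"
  by (simp add: internal_prod_def the_inv_ch assms)


section \<open>Subgroups of the symmetric group and their cosets\<close>

abbreviation perm_inv :: "('a \<Rightarrow> 'a) \<Rightarrow> ('a \<Rightarrow> 'a)" where
  "perm_inv f \<equiv> inv_into UNIV f"

definition perm_subgroup :: "nat \<Rightarrow> (nat \<Rightarrow> nat) set \<Rightarrow> bool" where
  "perm_subgroup d W \<longleftrightarrow> W \<subseteq> Sym d \<and> id \<in> W \<and> (\<forall>\<sigma>\<in>W. \<forall>\<tau>\<in>W. \<sigma> \<circ> \<tau> \<in> W) \<and> (\<forall>\<sigma>\<in>W. perm_inv \<sigma> \<in> W)"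

lemma Sym_comp: "\<sigma> \<in> Sym d \<Longrightarrow> \<tau> \<in> Sym d \<Longrightarrow> \<sigma> \<circ> \<tau> \<in> Sym d"
  by (simp add: permutes_compose)

lemma Sym_inv: "\<sigma> \<in> Sym d \<Longrightarrow> perm_inv \<sigma> \<in> Sym d"
  by (simp add: permutes_inv)

lemma Sym_id: "id \<in> Sym d"
  by (simp add: permutes_id)

lemma finite_Sym: "finite (Sym d)"
  by (simp add: finite_permutations)

lemma card_Sym: "card (Sym d) = fact d"
  by (simp add: card_permutations)

text \<open>The last two forms serve right-nested compositions; together with
  \<open>comp_assoc\<close> they simplify group words by rewriting.\<close>

lemma Sym_cancel:
  fixes \<sigma> \<tau> :: "nat \<Rightarrow> nat"
  assumes "\<sigma> \<in> Sym d"
  shows "\<sigma> \<circ> perm_inv \<sigma> = id" "perm_inv \<sigma> \<circ> \<sigma> = id"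
    "\<sigma> \<circ> (perm_inv \<sigma> \<circ> \<tau>) = \<tau>" "perm_inv \<sigma> \<circ> (\<sigma> \<circ> \<tau>) = \<tau>"
  using assms by (simp_all add: permutes_inv_o flip: comp_assoc)

lemma Sym_inv_comp:
  "\<sigma> \<in> Sym d \<Longrightarrow> \<tau> \<in> Sym d \<Longrightarrow> perm_inv (\<sigma> \<circ> \<tau>) = perm_inv \<tau> \<circ> perm_inv \<sigma>"
  by (intro o_inv_distrib) (auto simp: permutes_bij)

lemma Sym_inv_inv: "\<sigma> \<in> Sym d \<Longrightarrow> perm_inv (perm_inv \<sigma>) = \<sigma>"
  by (intro inv_inv_eq) (auto simp: permutes_bij)

lemma permutation_Sym: "\<sigma> \<in> Sym d \<Longrightarrow> permutation \<sigma>"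
  by (auto simp: permutation_permutes)

lemma perm_subgroupD:
  assumes "perm_subgroup d W"
  shows "\<sigma> \<in> W \<Longrightarrow> \<sigma> \<in> Sym d" "id \<in> W" "\<sigma> \<in> W \<Longrightarrow> \<tau> \<in> W \<Longrightarrow> \<sigma> \<circ> \<tau> \<in> W"
    "\<sigma> \<in> W \<Longrightarrow> perm_inv \<sigma> \<in> W"
  using assms unfolding perm_subgroup_def by blast+

lemma finite_perm_subgroup: "perm_subgroup d W \<Longrightarrow> finite W"
  unfolding perm_subgroup_def using finite_Sym finite_subset by blast

lemma card_perm_subgroup_pos: "perm_subgroup d W \<Longrightarrow> card W > 0"
  using finite_perm_subgroup perm_subgroupD(2) card_gt_0_iff by blast

lemma perm_subgroup_aut_group: "perm_subgroup d (aut_group d \<Gamma>)"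
  unfolding perm_subgroup_def
proof (intro conjI ballI)
  show "aut_group d \<Gamma> \<subseteq> Sym d" "id \<in> aut_group d \<Gamma>"
    by (auto simp: aut_group_def permutes_id)
next
  fix \<sigma> \<tau> assume "\<sigma> \<in> aut_group d \<Gamma>" "\<tau> \<in> aut_group d \<Gamma>"
  then show "\<sigma> \<circ> \<tau> \<in> aut_group d \<Gamma>"
    by (auto simp: aut_group_def permutes_compose permutes_in_image simp del: atLeastAtMost_iff)
next
  fix \<sigma> assume \<sigma>: "\<sigma> \<in> aut_group d \<Gamma>"
  then have perm: "\<sigma> permutes {1..d}"
    by (simp add: aut_group_def)
  have "count \<Gamma> (Upair (perm_inv \<sigma> i) (perm_inv \<sigma> j)) = count \<Gamma> (Upair i j)"
    if "i \<in> {1..d}" "j \<in> {1..d}" for i j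
  proof -
    have "perm_inv \<sigma> i \<in> {1..d}" "perm_inv \<sigma> j \<in> {1..d}"
      using that permutes_in_image[OF permutes_inv[OF perm]] by blast+
    then have "count \<Gamma> (Upair (\<sigma> (perm_inv \<sigma> i)) (\<sigma> (perm_inv \<sigma> j)))
        = count \<Gamma> (Upair (perm_inv \<sigma> i) (perm_inv \<sigma> j))"
      using \<sigma> unfolding aut_group_def by blast
    then show ?thesis
      by (simp add: permutes_inverses[OF perm])
  qed
  then show "perm_inv \<sigma> \<in> aut_group d \<Gamma>"
    using permutes_inv[OF perm] unfolding aut_group_def by blast
qed

section \<open>Coset spaces and fixed cosets\<close>

definition left_cosets :: "nat \<Rightarrow> (nat \<Rightarrow> nat) set \<Rightarrow> (nat \<Rightarrow> nat) set set" where
  "left_cosets d W = (\<lambda>\<tau>. (\<circ>) \<tau> ` W) ` Sym d"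

text \<open>For a subgroup W, the cardinality is the value at \<sigma> of the permutation character
  of S_d / W, that is, of the character induced from the trivial character of W.\<close>

definition fixed_cosets :: "nat \<Rightarrow> (nat \<Rightarrow> nat) set \<Rightarrow> (nat \<Rightarrow> nat) \<Rightarrow> (nat \<Rightarrow> nat) set set" where
  "fixed_cosets d W \<sigma> = {C \<in> left_cosets d W. (\<circ>) \<sigma> ` C = C}"

lemma image_comp_image: "(\<circ>) \<sigma> ` (\<circ>) \<tau> ` W = (\<circ>) (\<sigma> \<circ> \<tau>) ` W"
  by (simp add: image_image comp_assoc)

lemma mem_left_coset_iff:
  fixes \<sigma> \<tau> :: "nat \<Rightarrow> nat"
  assumes "\<tau> \<in> Sym d"
  shows "\<sigma> \<in> (\<circ>) \<tau> ` W \<longleftrightarrow> perm_inv \<tau> \<circ> \<sigma> \<in> W"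
proof
  assume "\<sigma> \<in> (\<circ>) \<tau> ` W"
  then obtain w where "w \<in> W" "\<sigma> = \<tau> \<circ> w"
    by blast
  then show "perm_inv \<tau> \<circ> \<sigma> \<in> W"
    by (simp only: Sym_cancel(4)[OF assms])
next
  assume "perm_inv \<tau> \<circ> \<sigma> \<in> W"
  then show "\<sigma> \<in> (\<circ>) \<tau> ` W"
    by (rule image_eqI[rotated]) (simp only: Sym_cancel(3)[OF assms])
qed

lemma left_coset_eq_iff:
  assumes W: "perm_subgroup d W" and "\<sigma> \<in> Sym d" "\<tau> \<in> Sym d"
  shows "(\<circ>) \<sigma> ` W = (\<circ>) \<tau> ` W \<longleftrightarrow> perm_inv \<tau> \<circ> \<sigma> \<in> W"
proof
  assume "(\<circ>) \<sigma> ` W = (\<circ>) \<tau> ` W"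
  then have "\<sigma> \<circ> id \<in> (\<circ>) \<tau> ` W"
    using perm_subgroupD(2)[OF W] by blast
  then show "perm_inv \<tau> \<circ> \<sigma> \<in> W"
    by (simp only: mem_left_coset_iff[OF assms(3)] comp_id)
next
  assume "perm_inv \<tau> \<circ> \<sigma> \<in> W"
  then obtain w where w: "w \<in> W" and \<sigma>: "\<sigma> = \<tau> \<circ> w"
    using mem_left_coset_iff[OF assms(3)] by blast
  have "(\<circ>) w ` W = W"
  proof
    show "(\<circ>) w ` W \<subseteq> W"
      using perm_subgroupD(3)[OF W w] by blast
    show "W \<subseteq> (\<circ>) w ` W"
      using mem_left_coset_iff[OF perm_subgroupD(1)[OF W w], of _ W]
        perm_subgroupD(3)[OF W perm_subgroupD(4)[OF W w]] by blast
  qed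
  then show "(\<circ>) \<sigma> ` W = (\<circ>) \<tau> ` W"
    by (simp add: \<sigma> flip: image_comp_image)
qed

lemma finite_left_cosets: "finite (left_cosets d W)"
  by (simp add: left_cosets_def finite_permutations)

lemma comp_image_left_cosets:
  "\<sigma> \<in> Sym d \<Longrightarrow> C \<in> left_cosets d W \<Longrightarrow> (\<circ>) \<sigma> ` C \<in> left_cosets d W"
  unfolding left_cosets_def using Sym_comp by (fastforce simp: image_comp_image)

text \<open>The coset of \<tau> is fixed by \<sigma> exactly when \<tau>^-1 \<sigma> \<tau> lies in
  W, so the set on the right is the disjoint union of the fixed cosets, each of size |W|.\<close>

lemma card_fixed_cosets:
  assumes W: "perm_subgroup d W" and \<sigma>: "\<sigma> \<in> Sym d"
  shows "card W * card (fixed_cosets d W \<sigma>) = card {\<tau> \<in> Sym d. perm_inv \<tau> \<circ> \<sigma> \<circ> \<tau> \<in> W}"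
proof -
  have fixed_iff: "(\<circ>) \<sigma> ` (\<circ>) \<tau> ` W = (\<circ>) \<tau> ` W \<longleftrightarrow> perm_inv \<tau> \<circ> \<sigma> \<circ> \<tau> \<in> W" if "\<tau> \<in> Sym d" for \<tau>
    unfolding image_comp_image left_coset_eq_iff[OF W Sym_comp[OF \<sigma> that] that] by (simp only: comp_assoc)
  have Un: "\<Union> (fixed_cosets d W \<sigma>) = {\<tau> \<in> Sym d. perm_inv \<tau> \<circ> \<sigma> \<circ> \<tau> \<in> W}" (is "_ = ?T")
  proof (intro equalityI subsetI)
    fix \<tau> assume "\<tau> \<in> \<Union> (fixed_cosets d W \<sigma>)"
    then obtain \<upsilon> where \<upsilon>: "\<upsilon> \<in> Sym d" "\<tau> \<in> (\<circ>) \<upsilon> ` W" "(\<circ>) \<sigma> ` (\<circ>) \<upsilon> ` W = (\<circ>) \<upsilon> ` W"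
      unfolding fixed_cosets_def left_cosets_def by blast
    then have \<tau>: "\<tau> \<in> Sym d"
      using Sym_comp perm_subgroupD(1)[OF W] by blast
    have "(\<circ>) \<tau> ` W = (\<circ>) \<upsilon> ` W"
      using \<upsilon> \<tau> by (simp only: left_coset_eq_iff[OF W] mem_left_coset_iff)
    then show "\<tau> \<in> ?T"
      using fixed_iff[OF \<tau>] \<tau> \<upsilon>(3) by simp
  next
    fix \<tau> assume \<tau>: "\<tau> \<in> ?T"
    then have "\<tau> \<circ> id \<in> (\<circ>) \<tau> ` W"
      using perm_subgroupD(2)[OF W] by blast
    then show "\<tau> \<in> \<Union> (fixed_cosets d W \<sigma>)"
      using \<tau> fixed_iff[of \<tau>] by (auto simp: fixed_cosets_def left_cosets_def)
  qed
  have fin: "finite (fixed_cosets d W \<sigma>)"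
    by (simp add: fixed_cosets_def finite_left_cosets)
  have "card C = card W" if C: "C \<in> fixed_cosets d W \<sigma>" for C
  proof -
    obtain \<tau> where "\<tau> \<in> Sym d" "C = (\<circ>) \<tau> ` W"
      using C unfolding fixed_cosets_def left_cosets_def by blast
    moreover from this have "inj_on ((\<circ>) \<tau>) W"
      by (metis Sym_cancel(4) inj_onI)
    ultimately show ?thesis
      by (simp add: card_image)
  qed
  moreover have "C \<inter> D = {}" if CD: "C \<in> fixed_cosets d W \<sigma>" "D \<in> fixed_cosets d W \<sigma>" "C \<noteq> D" for C D
  proof (rule ccontr)
    assume "C \<inter> D \<noteq> {}"
    then obtain \<tau> where \<tau>: "\<tau> \<in> C" "\<tau> \<in> D"
      by blast
    have "E = (\<circ>) \<tau> ` W" if E: "E \<in> fixed_cosets d W \<sigma>" "\<tau> \<in> E" for E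
    proof -
      obtain \<upsilon> where \<upsilon>: "\<upsilon> \<in> Sym d" "E = (\<circ>) \<upsilon> ` W"
        using E unfolding fixed_cosets_def left_cosets_def by blast
      moreover from this have "\<tau> \<in> Sym d"
        using E Un by blast
      ultimately show ?thesis
        using E by (metis left_coset_eq_iff[OF W] mem_left_coset_iff)
    qed
    then show False
      using CD \<tau> by blast
  qed
  moreover have "finite (\<Union> (fixed_cosets d W \<sigma>))"
    unfolding Un by (simp add: finite_permutations)
  ultimately show ?thesis
    using card_partition[OF fin] Un by metis
qed

text \<open>Frobenius reciprocity for the permutation character of S_d / W and a class function g,
  with denominators cleared. Both sides sum g(\<sigma>) over the pairs (\<sigma>, \<tau>) with
  \<tau>^-1 \<sigma> \<tau> in W.\<close>

lemma sum_fixed_cosets: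
  fixes g :: "(nat \<Rightarrow> nat) \<Rightarrow> 'a::field_char_0"
  assumes W: "perm_subgroup d W"
    and g: "\<And>\<sigma> \<tau>. \<sigma> \<in> Sym d \<Longrightarrow> \<tau> \<in> Sym d \<Longrightarrow> g (\<tau> \<circ> \<sigma> \<circ> perm_inv \<tau>) = g \<sigma>"
  shows "of_nat (card W) * (\<Sum>\<sigma>\<in>Sym d. of_nat (card (fixed_cosets d W \<sigma>)) * g \<sigma>) = fact d * (\<Sum>\<sigma>\<in>W. g \<sigma>)"
proof -
  have "of_nat (card W) * (\<Sum>\<sigma>\<in>Sym d. of_nat (card (fixed_cosets d W \<sigma>)) * g \<sigma>)
      = (\<Sum>\<sigma>\<in>Sym d. of_nat (card {\<tau> \<in> Sym d. perm_inv \<tau> \<circ> \<sigma> \<circ> \<tau> \<in> W}) * g \<sigma>)"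
    unfolding sum_distrib_left
    by (intro sum.cong refl) (simp only: card_fixed_cosets[OF W, symmetric] of_nat_mult mult.assoc)
  also have "\<dots> = (\<Sum>\<sigma>\<in>Sym d. \<Sum>\<tau>\<in>Sym d. if perm_inv \<tau> \<circ> \<sigma> \<circ> \<tau> \<in> W then g \<sigma> else 0)"
    by (intro sum.cong refl) (simp only: sum.inter_filter[OF finite_Sym, symmetric] sum_constant)
  also have "\<dots> = (\<Sum>\<tau>\<in>Sym d. \<Sum>\<sigma>\<in>Sym d. if perm_inv \<tau> \<circ> \<sigma> \<circ> \<tau> \<in> W then g \<sigma> else 0)"
    by (rule sum.swap)
  \<comment> \<open>For fixed \<tau>, conjugation maps the admissible \<sigma> bijectively onto W
    without changing g, so the inner sum is the same for every \<tau>.\<close>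
  also have "\<dots> = (\<Sum>\<tau>\<in>Sym d. \<Sum>\<sigma>\<in>W. g \<sigma>)"
  proof (rule sum.cong[OF refl])
    fix \<tau> assume \<tau>: "\<tau> \<in> Sym d"
    have "(\<Sum>\<sigma>\<in>Sym d. if perm_inv \<tau> \<circ> \<sigma> \<circ> \<tau> \<in> W then g \<sigma> else 0)
        = (\<Sum>\<sigma>\<in>{\<sigma> \<in> Sym d. perm_inv \<tau> \<circ> \<sigma> \<circ> \<tau> \<in> W}. g \<sigma>)"
      by (rule sum.inter_filter[OF finite_Sym, symmetric])
    also have "\<dots> = (\<Sum>\<sigma>\<in>W. g \<sigma>)"
    proof (rule sum.reindex_bij_witness[of _ "\<lambda>\<sigma>. \<tau> \<circ> \<sigma> \<circ> perm_inv \<tau>" "\<lambda>\<sigma>. perm_inv \<tau> \<circ> \<sigma> \<circ> \<tau>"])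
      fix \<sigma> assume \<sigma>: "\<sigma> \<in> {\<sigma> \<in> Sym d. perm_inv \<tau> \<circ> \<sigma> \<circ> \<tau> \<in> W}"
      show eq: "\<tau> \<circ> (perm_inv \<tau> \<circ> \<sigma> \<circ> \<tau>) \<circ> perm_inv \<tau> = \<sigma>"
        by (simp only: comp_assoc Sym_cancel[OF \<tau>] comp_id)
      show "perm_inv \<tau> \<circ> \<sigma> \<circ> \<tau> \<in> W"
        using \<sigma> by simp
      show "g (perm_inv \<tau> \<circ> \<sigma> \<circ> \<tau>) = g \<sigma>"
        using g[of "perm_inv \<tau> \<circ> \<sigma> \<circ> \<tau>" \<tau>] \<sigma> \<tau> perm_subgroupD(1)[OF W] eq by simp
    next
      fix \<sigma> assume \<sigma>: "\<sigma> \<in> W"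
      show eq: "perm_inv \<tau> \<circ> (\<tau> \<circ> \<sigma> \<circ> perm_inv \<tau>) \<circ> \<tau> = \<sigma>"
        by (simp only: comp_assoc Sym_cancel[OF \<tau>] comp_id)
      show "\<tau> \<circ> \<sigma> \<circ> perm_inv \<tau> \<in> {\<sigma> \<in> Sym d. perm_inv \<tau> \<circ> \<sigma> \<circ> \<tau> \<in> W}"
        using \<sigma> eq Sym_comp[OF Sym_comp[OF \<tau> perm_subgroupD(1)[OF W \<sigma>]] Sym_inv[OF \<tau>]] by simp
    qed
    finally show "(\<Sum>\<sigma>\<in>Sym d. if perm_inv \<tau> \<circ> \<sigma> \<circ> \<tau> \<in> W then g \<sigma> else 0) = (\<Sum>\<sigma>\<in>W. g \<sigma>)" .
  qed
  also have "\<dots> = fact d * (\<Sum>\<sigma>\<in>W. g \<sigma>)"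
    unfolding sum_constant card_Sym by simp
  finally show ?thesis .
qed

section \<open>Induced characters\<close>

text \<open>A one-dimensional character of the whole S_d; its restrictions to the subgroups are what
  gets induced.\<close>

definition linear_character :: "nat \<Rightarrow> ((nat \<Rightarrow> nat) \<Rightarrow> 'a::field) \<Rightarrow> bool" where
  "linear_character d c \<longleftrightarrow> c id = 1 \<and> (\<forall>\<sigma>\<in>Sym d. \<forall>\<tau>\<in>Sym d. c (\<sigma> \<circ> \<tau>) = c \<sigma> * c \<tau>)"

lemma linear_character_1: "linear_character d (\<lambda>_. 1)"
  by (simp add: linear_character_def)

lemma linear_character_sign: "linear_character d (\<lambda>\<sigma>. of_int (sign \<sigma>))"
  unfolding linear_character_def by (simp add: sign_compose[OF permutation_Sym permutation_Sym, of _ d _ d])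

lemma linear_character_conjugate:
  assumes "linear_character d c" "\<sigma> \<in> Sym d" "\<tau> \<in> Sym d"
  shows "c (\<tau> \<circ> \<sigma> \<circ> perm_inv \<tau>) = c \<sigma>"
proof -
  have "c (\<tau> \<circ> \<sigma> \<circ> perm_inv \<tau>) = c \<tau> * c \<sigma> * c (perm_inv \<tau>)"
    using assms Sym_inv[OF assms(3)] Sym_comp[OF assms(3,2)] unfolding linear_character_def by metis
  also have "\<dots> = c (\<tau> \<circ> perm_inv \<tau>) * c \<sigma>"
    using assms Sym_inv[OF assms(3)] unfolding linear_character_def by (metis mult.assoc mult.commute)
  also have "\<dots> = c \<sigma>"
    using assms(1) unfolding Sym_cancel(1)[OF assms(3)] linear_character_def by simp
  finally show ?thesis .
qed

text \<open>The permutation matrices of the action, scaled by c(\<sigma>), form a representation. A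
  diagonal entry is c(\<sigma>) at a fixed point and 0 elsewhere.\<close>

lemma signed_permutation_character:
  fixes act :: "(nat \<Rightarrow> nat) \<Rightarrow> 'x \<Rightarrow> 'x" and c :: "(nat \<Rightarrow> nat) \<Rightarrow> 'a::field"
  assumes fin: "finite X"
    and act_in: "\<And>\<sigma> x. \<sigma> \<in> Sym d \<Longrightarrow> x \<in> X \<Longrightarrow> act \<sigma> x \<in> X"
    and act_id: "\<And>x. x \<in> X \<Longrightarrow> act id x = x"
    and act_comp: "\<And>\<sigma> \<tau> x. \<sigma> \<in> Sym d \<Longrightarrow> \<tau> \<in> Sym d \<Longrightarrow> x \<in> X \<Longrightarrow> act (\<sigma> \<circ> \<tau>) x = act \<sigma> (act \<tau> x)"
    and c: "linear_character d c"
  shows "(\<lambda>\<sigma>\<in>Sym d. c \<sigma> * of_nat (card {x \<in> X. act \<sigma> x = x})) \<in> characters d"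
proof -
  obtain e where e: "bij_betw e {0..<card X} X"
    using ex_bij_betw_nat_finite[OF fin] by blast
  define n where "n = card X"
  have e_in: "e i \<in> X" if "i < n" for i
    using bij_betwE[OF e] that by (simp add: n_def)
  have e_inj: "e i = e j \<longleftrightarrow> i = j" if "i < n" "j < n" for i j
    using bij_betw_imp_inj_on[OF e] that by (auto simp: n_def inj_on_def)
  have e_surj: "\<exists>i<n. e i = x" if "x \<in> X" for x
    using bij_betw_imp_surj_on[OF e] that by (metis atLeastLessThan_iff imageE n_def)
  define \<rho> where "\<rho> \<sigma> = mat n n (\<lambda>(i, j). if act \<sigma> (e j) = e i then c \<sigma> else 0)" for \<sigma>
  have "representation d n \<rho>"
    unfolding representation_def
  proof (intro conjI ballI)
    show "\<rho> \<sigma> \<in> carrier_mat n n" for \<sigma>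
      by (simp add: \<rho>_def)
    show "\<rho> id = 1\<^sub>m n"
      using c by (intro eq_matI) (auto simp: \<rho>_def act_id e_in e_inj linear_character_def)
  next
    fix \<sigma> \<tau> assume \<sigma>: "\<sigma> \<in> Sym d" and \<tau>: "\<tau> \<in> Sym d"
    show "\<rho> (\<sigma> \<circ> \<tau>) = \<rho> \<sigma> * \<rho> \<tau>"
    proof (rule eq_matI)
      fix i j assume "i < dim_row (\<rho> \<sigma> * \<rho> \<tau>)" "j < dim_col (\<rho> \<sigma> * \<rho> \<tau>)"
      then have ij: "i < n" "j < n"
        by (simp_all add: \<rho>_def)
      \<comment> \<open>Column j of the matrix of \<tau> vanishes outside row k, so only l = k
        survives in the matrix product.\<close>
      obtain k where k: "k < n" "e k = act \<tau> (e j)"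
        using e_surj[OF act_in[OF \<tau> e_in[OF ij(2)]]] by blast
      have "(\<rho> \<sigma> * \<rho> \<tau>) $$ (i, j)
          = (\<Sum>l<n. (if act \<sigma> (e l) = e i then c \<sigma> else 0) * (if act \<tau> (e j) = e l then c \<tau> else 0))"
        using ij by (simp add: \<rho>_def scalar_prod_def atLeast0LessThan)
      also have "\<dots> = (\<Sum>l<n. if l = k then (if act \<sigma> (e k) = e i then c \<sigma> else 0) * c \<tau> else 0)"
        using k by (intro sum.cong) (auto simp: e_inj simp flip: k(2))
      also have "\<dots> = \<rho> (\<sigma> \<circ> \<tau>) $$ (i, j)"
        using ij k act_comp[OF \<sigma> \<tau> e_in[OF ij(2)]] c \<sigma> \<tau>
        by (simp add: \<rho>_def linear_character_def)
      finally show "\<rho> (\<sigma> \<circ> \<tau>) $$ (i, j) = (\<rho> \<sigma> * \<rho> \<tau>) $$ (i, j)" ..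
    qed (simp_all add: \<rho>_def)
  qed
  moreover have "mat_trace (\<rho> \<sigma>) = c \<sigma> * of_nat (card {x \<in> X. act \<sigma> x = x})" for \<sigma>
  proof -
    have "{x \<in> X. act \<sigma> x = x} = e ` {i \<in> {..<n}. act \<sigma> (e i) = e i}"
      using e_in e_surj by blast
    moreover have "inj_on e {i \<in> {..<n}. act \<sigma> (e i) = e i}"
      using e_inj by (auto simp: inj_on_def)
    ultimately have "card {x \<in> X. act \<sigma> x = x} = card {i \<in> {..<n}. act \<sigma> (e i) = e i}"
      by (simp add: card_image)
    moreover have "mat_trace (\<rho> \<sigma>) = (\<Sum>i\<in>{i \<in> {..<n}. act \<sigma> (e i) = e i}. c \<sigma>)"
      by (subst sum.inter_filter) (auto simp: mat_trace_def \<rho>_def intro!: sum.cong)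
    ultimately show ?thesis
      by (simp add: mult.commute)
  qed
  then have "(\<lambda>\<sigma>\<in>Sym d. c \<sigma> * of_nat (card {x \<in> X. act \<sigma> x = x})) = (\<lambda>\<sigma>\<in>Sym d. mat_trace (\<rho> \<sigma>))"
    by simp
  ultimately show ?thesis
    unfolding characters_def by blast
qed

lemma character_imp_generalized:
  assumes "\<chi> \<in> characters d"
  shows "\<chi> \<in> generalized_characters d"
proof -
  have "\<chi> \<in> extensional (Sym d)"
    using assms unfolding characters_def by (auto simp only: restrict_extensional)
  then have "\<chi> = (\<lambda>\<sigma>\<in>Sym d. (\<lambda>\<sigma>\<in>Sym d. 0) \<sigma> + \<chi> \<sigma>)"
    by (intro extensionalityI[where A = "Sym d"]) simp_all
  then show ?thesis
    using generalized_characters.add[OF generalized_characters.zero assms] by simp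
qed

text \<open>
  The product of the characters induced from the trivial characters of the \<open>W m\<close> is the permutation
  character of $\prod_m S_d / W_m$.
\<close>

lemma prod_card_fixed_cosets_generalized_character:
  fixes c :: "(nat \<Rightarrow> nat) \<Rightarrow> 'a::field"
  assumes "finite I" and c: "linear_character d c"
  shows "(\<lambda>\<sigma>\<in>Sym d. c \<sigma> * (\<Prod>m\<in>I. of_nat (card (fixed_cosets d (W m) \<sigma>)))) \<in> generalized_characters d"
proof -
  define X where "X = (\<Pi>\<^sub>E m\<in>I. left_cosets d (W m))"
  define act where "act = (\<lambda>(\<sigma> :: nat \<Rightarrow> nat) f. \<lambda>m\<in>I. (\<circ>) \<sigma> ` (f m :: (nat \<Rightarrow> nat) set))"
  have "finite X"
    using assms(1) by (simp add: X_def finite_PiE finite_left_cosets)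
  moreover have "act \<sigma> x \<in> X" if "\<sigma> \<in> Sym d" "x \<in> X" for \<sigma> x
    using that comp_image_left_cosets unfolding X_def act_def by (fastforce simp: PiE_iff)
  moreover have "act id x = x" if "x \<in> X" for x
    using that by (auto simp: X_def act_def PiE_iff extensional_def fun_eq_iff)
  moreover have "act (\<sigma> \<circ> \<tau>) x = act \<sigma> (act \<tau> x)" for \<sigma> \<tau> x
    by (auto simp: act_def image_comp_image fun_eq_iff)
  ultimately have "(\<lambda>\<sigma>\<in>Sym d. c \<sigma> * of_nat (card {x \<in> X. act \<sigma> x = x})) \<in> characters d"
    using c by (intro signed_permutation_character)
  moreover have "{x \<in> X. act \<sigma> x = x} = (\<Pi>\<^sub>E m\<in>I. fixed_cosets d (W m) \<sigma>)" for \<sigma>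
  proof -
    have fixed_iff: "act \<sigma> x = x \<longleftrightarrow> (\<forall>m\<in>I. (\<circ>) \<sigma> ` x m = x m)" if "x \<in> extensional I" for x
    proof -
      have "act \<sigma> x \<in> extensional I"
        by (simp add: act_def)
      then have "act \<sigma> x = x \<longleftrightarrow> (\<forall>m\<in>I. act \<sigma> x m = x m)"
        using extensionalityI[OF _ that] by metis
      then show ?thesis
        by (simp add: act_def)
    qed
    have "x \<in> {x \<in> X. act \<sigma> x = x} \<longleftrightarrow> x \<in> (\<Pi>\<^sub>E m\<in>I. fixed_cosets d (W m) \<sigma>)" for x
      unfolding X_def PiE_iff fixed_cosets_def mem_Collect_eq using fixed_iff[of x] by metis
    then show ?thesis
      by (rule Set.set_eqI)
  qed
  ultimately show ?thesis
    using assms(1) by (simp add: card_PiE character_imp_generalized)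
qed

section \<open>Cycle indices as characteristics of induced characters\<close>

lemma cycle_monomial_conjugate:
  assumes "\<sigma> \<in> Sym d" "\<tau> \<in> Sym d"
  shows "cycle_monomial d (\<tau> \<circ> \<sigma> \<circ> perm_inv \<tau>) = cycle_monomial d \<sigma>"
proof -
  have "\<tau> \<circ> \<sigma> = (\<tau> \<circ> \<sigma> \<circ> perm_inv \<tau>) \<circ> \<tau>"
    by (simp only: comp_assoc Sym_cancel[OF assms(2)] comp_id)
  from num_cycles_conjugate[OF assms(2,1) this] show ?thesis
    by (simp add: cycle_monomial_def)
qed

text \<open>The argument of \<open>ch\<close> is the character induced from the restriction of c to
  W, written as c times the permutation character. Coefficientwise this is
  \<open>sum_fixed_cosets\<close> for the class function c times the coefficient of the cycle
  monomial.\<close>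

lemma cycle_index_eq_ch:
  fixes c :: "(nat \<Rightarrow> nat) \<Rightarrow> 'a::field_char_0"
  assumes W: "perm_subgroup d W" and c: "linear_character d c"
  shows "cycle_index d W (\<lambda>\<sigma>\<in>W. c \<sigma>) = ch d (\<lambda>\<sigma>\<in>Sym d. c \<sigma> * of_nat (card (fixed_cosets d W \<sigma>)))"
proof (rule mseries_eqI)
  fix m
  define g where "g \<sigma> = c \<sigma> * mcoeff (cycle_monomial d \<sigma> :: 'a mseries) m" for \<sigma>
  have g: "g (\<tau> \<circ> \<sigma> \<circ> perm_inv \<tau>) = g \<sigma>" if "\<sigma> \<in> Sym d" "\<tau> \<in> Sym d" for \<sigma> \<tau>
    using that by (simp only: g_def cycle_monomial_conjugate linear_character_conjugate[OF c])
  have "mcoeff (cycle_index d W (\<lambda>\<sigma>\<in>W. c \<sigma>)) m = (\<Sum>\<sigma>\<in>W. g \<sigma>) / of_nat (card W)"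
    by (simp add: cycle_index_def mscale.rep_eq mcoeff_sum g_def)
  also have "\<dots> = (\<Sum>\<sigma>\<in>Sym d. of_nat (card (fixed_cosets d W \<sigma>)) * g \<sigma>) / fact d"
    using sum_fixed_cosets[OF W g] card_perm_subgroup_pos[OF W]
    by (simp add: frac_eq_eq mult.commute)
  also have "\<dots> = mcoeff (ch d (\<lambda>\<sigma>\<in>Sym d. c \<sigma> * of_nat (card (fixed_cosets d W \<sigma>)))) m"
    by (simp add: ch_def mscale.rep_eq mcoeff_sum g_def mult_ac)
  finally show "mcoeff (cycle_index d W (\<lambda>\<sigma>\<in>W. c \<sigma>)) m
      = mcoeff (ch d (\<lambda>\<sigma>\<in>Sym d. c \<sigma> * of_nat (card (fixed_cosets d W \<sigma>)))) m" .
qed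

text \<open>The linear character enters with the first factor only, yet multiplies the whole
  product. Each use of \<open>internal_prod_ch\<close> needs the partial product to be a generalized
  character again, hence its description by fixed cosets.\<close>

lemma foldl_internal_prod_cycle_index:
  fixes c :: "(nat \<Rightarrow> nat) \<Rightarrow> 'a::field_char_0"
  assumes c: "linear_character d c" and "k \<ge> 1"
    and W: "\<And>m. m \<in> {1..k} \<Longrightarrow> perm_subgroup d (W m)"
  shows "foldl (internal_prod d) (cycle_index d (W 1) (\<lambda>\<sigma>\<in>W 1. c \<sigma>))
      (map (\<lambda>m. cycle_index d (W m) (\<lambda>\<sigma>\<in>W m. 1)) [2..<k + 1])
    = ch d (\<lambda>\<sigma>\<in>Sym d. c \<sigma> * (\<Prod>m=1..k. of_nat (card (fixed_cosets d (W m) \<sigma>))))"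
  using assms(2,3)
proof (induction k rule: nat_induct_at_least)
  \<comment> \<open>For k = 1 the list \<open>[2..<k + 1]\<close> is empty and only the first cycle
    index remains.\<close>
  case base
  then have "perm_subgroup d (W 1)"
    by simp
  from cycle_index_eq_ch[OF this c] show ?case
    by (simp del: restrict_apply)
next
  case (Suc k)
  let ?u = "\<lambda>\<sigma>\<in>Sym d. c \<sigma> * (\<Prod>m=1..k. of_nat (card (fixed_cosets d (W m) \<sigma>)))"
  \<comment> \<open>The factor 1 is the trivial linear character, kept so that
    \<open>cycle_index_eq_ch\<close> matches.\<close>
  let ?v = "\<lambda>\<sigma>\<in>Sym d. 1 * of_nat (card (fixed_cosets d (W (Suc k)) \<sigma>)) :: 'a"
  have u: "?u \<in> generalized_characters d"
    by (rule prod_card_fixed_cosets_generalized_character[OF finite_atLeastAtMost c])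
  have v: "?v \<in> generalized_characters d"
    using prod_card_fixed_cosets_generalized_character[of "{Suc k}" d "\<lambda>_. 1 :: 'a" W, OF _ linear_character_1]
    by simp
  have IH: "foldl (internal_prod d) (cycle_index d (W 1) (\<lambda>\<sigma>\<in>W 1. c \<sigma>))
      (map (\<lambda>m. cycle_index d (W m) (\<lambda>\<sigma>\<in>W m. 1)) [2..<k + 1]) = ch d ?u"
    by (rule Suc.IH) (simp add: Suc.prems)
  have "[2..<Suc k + 1] = [2..<k + 1] @ [Suc k]"
    using Suc.hyps by (simp add: upt_Suc_append)
  then have "foldl (internal_prod d) (cycle_index d (W 1) (\<lambda>\<sigma>\<in>W 1. c \<sigma>))
      (map (\<lambda>m. cycle_index d (W m) (\<lambda>\<sigma>\<in>W m. 1)) [2..<Suc k + 1])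
    = internal_prod d (ch d ?u) (cycle_index d (W (Suc k)) (\<lambda>\<sigma>\<in>W (Suc k). 1))"
    by (simp only: map_append list.map foldl_append foldl.simps IH)
  also have "cycle_index d (W (Suc k)) (\<lambda>\<sigma>\<in>W (Suc k). 1) = ch d ?v"
    by (rule cycle_index_eq_ch[OF _ linear_character_1]) (simp add: Suc.prems)
  also have "internal_prod d (ch d ?u) (ch d ?v) = ch d (\<lambda>\<sigma>\<in>Sym d. ?u \<sigma> * ?v \<sigma>)"
    by (rule internal_prod_ch[OF u v])
  also have "(\<lambda>\<sigma>\<in>Sym d. ?u \<sigma> * ?v \<sigma>)
      = (\<lambda>\<sigma>\<in>Sym d. c \<sigma> * (\<Prod>m=1..Suc k. of_nat (card (fixed_cosets d (W m) \<sigma>))))"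
    by (rule restrict_ext) (simp add: mult.assoc)
  finally show ?case .
qed


section \<open>Counting superpositions\<close>

text \<open>Translation by an odd element permutes H and flips every sign, so the sum equals its own
  negative and vanishes in characteristic zero.\<close>

lemma sum_sign_perm_subgroup:
  assumes H: "perm_subgroup d H"
  shows "(\<Sum>\<sigma>\<in>H. of_int (sign \<sigma>)) = (if \<forall>\<sigma>\<in>H. evenperm \<sigma> then of_nat (card H) else 0 :: 'a::field_char_0)"
proof (cases "\<forall>\<sigma>\<in>H. evenperm \<sigma>")
  case True
  then show ?thesis
    by (simp add: sign_def)
next
  case False
  then obtain \<tau> where \<tau>: "\<tau> \<in> H" "\<not> evenperm \<tau>"
    by blast
  have \<tau>': "\<tau> \<in> Sym d"
    by (rule perm_subgroupD(1)[OF H \<tau>(1)])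
  have "(\<Sum>\<sigma>\<in>H. of_int (sign \<sigma>)) = (\<Sum>\<sigma>\<in>H. of_int (sign (\<tau> \<circ> \<sigma>)) :: 'a)"
    by (rule sum.reindex_bij_witness[of _ "\<lambda>\<sigma>. \<tau> \<circ> \<sigma>" "\<lambda>\<sigma>. perm_inv \<tau> \<circ> \<sigma>"])
       (simp_all only: Sym_cancel[OF \<tau>'] perm_subgroupD(3,4)[OF H] \<tau>(1))
  also have "\<dots> = (\<Sum>\<sigma>\<in>H. - of_int (sign \<sigma>))"
  proof (rule sum.cong[OF refl])
    fix \<sigma> assume "\<sigma> \<in> H"
    then have "sign (\<tau> \<circ> \<sigma>) = sign \<tau> * sign \<sigma>"
      by (intro sign_compose permutation_Sym[of _ d] \<tau>' perm_subgroupD(1)[OF H])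
    then show "of_int (sign (\<tau> \<circ> \<sigma>)) = (- of_int (sign \<sigma>) :: 'a)"
      using \<tau>(2) by (simp add: sign_def)
  qed
  finally have "(\<Sum>\<sigma>\<in>H. of_int (sign \<sigma>)) = - (\<Sum>\<sigma>\<in>H. of_int (sign \<sigma>) :: 'a)"
    by (simp add: sum_negf)
  then show ?thesis
    using False by auto
qed

section \<open>Superpositions as classes of placements\<close>

context
  fixes d k :: nat and W :: "nat \<Rightarrow> (nat \<Rightarrow> nat) set"
  assumes k: "k \<ge> 1" and W: "\<And>m. m \<in> {1..k} \<Longrightarrow> perm_subgroup d (W m)"
begin

lemma placementD: "a \<in> placements d k \<Longrightarrow> m \<in> {1..k} \<Longrightarrow> a m \<in> Sym d"
  unfolding placements_def by (rule PiE_mem)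

lemma finite_placements: "finite (placements d k)"
  unfolding placements_def by (intro finite_PiE finite_atLeastAtMost finite_Sym)

definition move :: "(nat \<Rightarrow> nat) \<Rightarrow> (nat \<Rightarrow> nat \<Rightarrow> nat) \<Rightarrow> (nat \<Rightarrow> nat \<Rightarrow> nat) \<Rightarrow> (nat \<Rightarrow> nat \<Rightarrow> nat)" where
  "move \<zeta> a w = (\<lambda>m\<in>{1..k}. \<zeta> \<circ> a m \<circ> w m)"

lemma move_apply: "m \<in> {1..k} \<Longrightarrow> move \<zeta> a w m = \<zeta> \<circ> a m \<circ> w m"
  by (simp add: move_def)

lemma move_placement:
  assumes "\<zeta> \<in> Sym d" "a \<in> placements d k" "\<And>m. m \<in> {1..k} \<Longrightarrow> w m \<in> W m"
  shows "move \<zeta> a w \<in> placements d k"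
  unfolding placements_def move_def
proof (rule restrict_PiE_iff[THEN iffD2], rule ballI)
  fix m assume m: "m \<in> {1..k}"
  show "\<zeta> \<circ> a m \<circ> w m \<in> Sym d"
    by (intro Sym_comp assms(1) placementD[OF assms(2) m] perm_subgroupD(1)[OF W[OF m] assms(3)[OF m]])
qed

lemma placement_eqI:
  "a \<in> placements d k \<Longrightarrow> b \<in> placements d k \<Longrightarrow> (\<And>m. m \<in> {1..k} \<Longrightarrow> a m = b m) \<Longrightarrow> a = b"
  unfolding placements_def by (rule PiE_ext)

lemma same_superpositionI:
  assumes "a \<in> placements d k" "b \<in> placements d k" "\<zeta> \<in> Sym d"
    and "\<And>m. m \<in> {1..k} \<Longrightarrow> w m \<in> W m" "\<And>m. m \<in> {1..k} \<Longrightarrow> b m = \<zeta> \<circ> a m \<circ> w m"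
  shows "(a, b) \<in> same_superposition d k W"
proof -
  have "\<exists>w. \<forall>m\<in>{1..k}. w m \<in> W m \<and> b m = \<zeta> \<circ> a m \<circ> w m"
    using assms(4,5) by (intro exI[of _ w] ballI conjI)
  then show ?thesis
    using assms(1-3) unfolding same_superposition_def by blast
qed

text \<open>The existential w is made extensional, so that the witnesses range over a finite set
  whose size is the product of the |W_m|.\<close>

lemma same_superposition_iff:
  "(a, b) \<in> same_superposition d k W \<longleftrightarrow>
    a \<in> placements d k \<and> (\<exists>\<zeta>\<in>Sym d. \<exists>w\<in>Pi\<^sub>E {1..k} W. b = move \<zeta> a w)"
proof
  assume "(a, b) \<in> same_superposition d k W"
  then obtain \<zeta> w where a: "a \<in> placements d k" "b \<in> placements d k" and \<zeta>: "\<zeta> \<in> Sym d"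
    and w: "\<And>m. m \<in> {1..k} \<Longrightarrow> w m \<in> W m \<and> b m = \<zeta> \<circ> a m \<circ> w m"
    unfolding same_superposition_def by blast
  have "restrict w {1..k} \<in> Pi\<^sub>E {1..k} W"
    using w by (simp only: restrict_PiE_iff) blast
  moreover have "b = move \<zeta> a (restrict w {1..k})"
    using w \<zeta> a by (intro placement_eqI move_placement) (simp_all add: move_apply)
  ultimately show "a \<in> placements d k \<and> (\<exists>\<zeta>\<in>Sym d. \<exists>w\<in>Pi\<^sub>E {1..k} W. b = move \<zeta> a w)"
    using a(1) \<zeta> by blast
next
  assume "a \<in> placements d k \<and> (\<exists>\<zeta>\<in>Sym d. \<exists>w\<in>Pi\<^sub>E {1..k} W. b = move \<zeta> a w)"
  then obtain \<zeta> w where a: "a \<in> placements d k" and \<zeta>: "\<zeta> \<in> Sym d" and w: "w \<in> Pi\<^sub>E {1..k} W"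
    and b: "b = move \<zeta> a w"
    by blast
  have w': "w m \<in> W m" if "m \<in> {1..k}" for m
    using w that by (rule PiE_mem)
  have "b \<in> placements d k"
    unfolding b using \<zeta> a w' by (rule move_placement)
  then show "(a, b) \<in> same_superposition d k W"
    using a \<zeta> w' by (intro same_superpositionI[where w = w]) (simp_all only: b move_apply)
qed

lemma equiv_same_superposition: "equiv (placements d k) (same_superposition d k W)"
proof (rule equivI)
  show "same_superposition d k W \<subseteq> placements d k \<times> placements d k"
    unfolding same_superposition_def by blast
  show "refl_on (placements d k) (same_superposition d k W)"
  proof (rule refl_onI)
    fix a assume "a \<in> placements d k"
    then show "(a, a) \<in> same_superposition d k W"
      using Sym_id perm_subgroupD(2)[OF W]
      by (intro same_superpositionI[where \<zeta> = id and w = "\<lambda>_. id"]) (simp_all only: id_comp comp_id)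
  qed
  show "sym (same_superposition d k W)"
  proof (rule symI)
    fix a b assume "(a, b) \<in> same_superposition d k W"
    then obtain \<zeta> w where ab: "a \<in> placements d k" "b \<in> placements d k" and \<zeta>: "\<zeta> \<in> Sym d"
      and w: "\<And>m. m \<in> {1..k} \<Longrightarrow> w m \<in> W m \<and> b m = \<zeta> \<circ> a m \<circ> w m"
      unfolding same_superposition_def by blast
    show "(b, a) \<in> same_superposition d k W"
    proof (rule same_superpositionI[OF ab(2,1) Sym_inv[OF \<zeta>], where w = "\<lambda>m. perm_inv (w m)"])
      fix m assume m: "m \<in> {1..k}"
      have wm: "w m \<in> W m" "w m \<in> Sym d"
        using w[OF m] perm_subgroupD(1)[OF W[OF m]] by blast+
      show "perm_inv (w m) \<in> W m"
        by (rule perm_subgroupD(4)[OF W[OF m] wm(1)])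
      show "a m = perm_inv \<zeta> \<circ> b m \<circ> perm_inv (w m)"
        by (simp only: w[OF m, THEN conjunct2] comp_assoc Sym_cancel[OF \<zeta>] Sym_cancel[OF wm(2)] comp_id)
    qed
  qed
  show "trans (same_superposition d k W)"
  proof (rule transI)
    fix a b c assume "(a, b) \<in> same_superposition d k W" "(b, c) \<in> same_superposition d k W"
    then obtain \<zeta> w \<xi> v where ac: "a \<in> placements d k" "c \<in> placements d k"
      and \<zeta>: "\<zeta> \<in> Sym d" and w: "\<And>m. m \<in> {1..k} \<Longrightarrow> w m \<in> W m \<and> b m = \<zeta> \<circ> a m \<circ> w m"
      and \<xi>: "\<xi> \<in> Sym d" and v: "\<And>m. m \<in> {1..k} \<Longrightarrow> v m \<in> W m \<and> c m = \<xi> \<circ> b m \<circ> v m"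
      unfolding same_superposition_def by blast
    show "(a, c) \<in> same_superposition d k W"
    proof (rule same_superpositionI[OF ac Sym_comp[OF \<xi> \<zeta>], where w = "\<lambda>m. w m \<circ> v m"])
      fix m assume m: "m \<in> {1..k}"
      show "w m \<circ> v m \<in> W m"
        using w[OF m] v[OF m] perm_subgroupD(3)[OF W[OF m]] by blast
      show "c m = (\<xi> \<circ> \<zeta>) \<circ> a m \<circ> (w m \<circ> v m)"
        by (simp only: w[OF m, THEN conjunct2] v[OF m, THEN conjunct2] comp_assoc)
    qed
  qed
qed

lemma mem_superposition_aut_iff:
  assumes a: "a \<in> placements d k"
  shows "\<sigma> \<in> superposition_aut k W a \<longleftrightarrow>
    \<sigma> \<in> Sym d \<and> (\<forall>m\<in>{1..k}. perm_inv (a m) \<circ> \<sigma> \<circ> a m \<in> W m)"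
proof -
  have conj: "\<sigma> \<in> {a m \<circ> w \<circ> perm_inv (a m) | w. w \<in> W m} \<longleftrightarrow>
      \<sigma> \<in> Sym d \<and> perm_inv (a m) \<circ> \<sigma> \<circ> a m \<in> W m" if m: "m \<in> {1..k}" for m
  proof
    note am = placementD[OF a m]
    assume "\<sigma> \<in> {a m \<circ> w \<circ> perm_inv (a m) | w. w \<in> W m}"
    then obtain w where w: "w \<in> W m" and \<sigma>: "\<sigma> = a m \<circ> w \<circ> perm_inv (a m)"
      by blast
    have "\<sigma> \<in> Sym d"
      unfolding \<sigma> by (intro Sym_comp Sym_inv am perm_subgroupD(1)[OF W[OF m] w])
    moreover have "perm_inv (a m) \<circ> \<sigma> \<circ> a m \<in> W m"
      using w by (simp only: \<sigma> comp_assoc Sym_cancel[OF am] comp_id)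
    ultimately show "\<sigma> \<in> Sym d \<and> perm_inv (a m) \<circ> \<sigma> \<circ> a m \<in> W m" ..
  next
    assume "\<sigma> \<in> Sym d \<and> perm_inv (a m) \<circ> \<sigma> \<circ> a m \<in> W m"
    moreover have "\<sigma> = a m \<circ> (perm_inv (a m) \<circ> \<sigma> \<circ> a m) \<circ> perm_inv (a m)"
      by (simp only: comp_assoc Sym_cancel[OF placementD[OF a m]] comp_id)
    ultimately show "\<sigma> \<in> {a m \<circ> w \<circ> perm_inv (a m) | w. w \<in> W m}"
      by blast
  qed
  have "\<sigma> \<in> superposition_aut k W a \<longleftrightarrow>
      (\<forall>m\<in>{1..k}. \<sigma> \<in> Sym d \<and> perm_inv (a m) \<circ> \<sigma> \<circ> a m \<in> W m)"
    unfolding superposition_aut_def INT_iff by (intro ball_cong refl conj)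
  \<comment> \<open>An intersection over no indices would contain every function; as k is at least
    1, some index forces \<sigma> into \<open>Sym d\<close>.\<close>
  moreover have "{1..k} \<noteq> {}"
    using k by simp
  ultimately show ?thesis
    by blast
qed

lemma perm_subgroup_superposition_aut:
  assumes a: "a \<in> placements d k"
  shows "perm_subgroup d (superposition_aut k W a)"
  unfolding perm_subgroup_def subset_iff mem_superposition_aut_iff[OF a]
proof (intro conjI ballI allI impI)
  show "id \<in> Sym d"
    by (rule Sym_id)
  show "perm_inv (a m) \<circ> id \<circ> a m \<in> W m" if m: "m \<in> {1..k}" for m
    using perm_subgroupD(2)[OF W[OF m]] by (simp only: comp_id Sym_cancel[OF placementD[OF a m]])
next
  fix \<sigma> \<tau> assume \<sigma>: "\<sigma> \<in> superposition_aut k W a" and \<tau>: "\<tau> \<in> superposition_aut k W a"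
  show "\<sigma> \<circ> \<tau> \<in> Sym d"
    using \<sigma> \<tau> Sym_comp unfolding mem_superposition_aut_iff[OF a] by blast
  fix m assume m: "m \<in> {1..k}"
  have "perm_inv (a m) \<circ> (\<sigma> \<circ> \<tau>) \<circ> a m = (perm_inv (a m) \<circ> \<sigma> \<circ> a m) \<circ> (perm_inv (a m) \<circ> \<tau> \<circ> a m)"
    by (simp only: comp_assoc Sym_cancel[OF placementD[OF a m]])
  moreover have "perm_inv (a m) \<circ> \<sigma> \<circ> a m \<in> W m" "perm_inv (a m) \<circ> \<tau> \<circ> a m \<in> W m"
    using \<sigma> \<tau> m unfolding mem_superposition_aut_iff[OF a] by blast+
  ultimately show "perm_inv (a m) \<circ> (\<sigma> \<circ> \<tau>) \<circ> a m \<in> W m"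
    by (simp only: perm_subgroupD(3)[OF W[OF m]])
next
  fix \<sigma> assume \<sigma>: "\<sigma> \<in> superposition_aut k W a"
  then have \<sigma>': "\<sigma> \<in> Sym d"
    unfolding mem_superposition_aut_iff[OF a] by blast
  then show "perm_inv \<sigma> \<in> Sym d"
    by (rule Sym_inv)
  fix m assume m: "m \<in> {1..k}"
  note am = placementD[OF a m]
  have "perm_inv (perm_inv (a m) \<circ> \<sigma> \<circ> a m) = perm_inv (a m) \<circ> perm_inv \<sigma> \<circ> a m"
    unfolding Sym_inv_comp[OF Sym_comp[OF Sym_inv[OF am] \<sigma>'] am] Sym_inv_comp[OF Sym_inv[OF am] \<sigma>']
      Sym_inv_inv[OF am] by (simp only: comp_assoc)
  moreover have "perm_inv (a m) \<circ> \<sigma> \<circ> a m \<in> W m"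
    using \<sigma> m unfolding mem_superposition_aut_iff[OF a] by blast
  ultimately show "perm_inv (a m) \<circ> perm_inv \<sigma> \<circ> a m \<in> W m"
    using perm_subgroupD(4)[OF W[OF m]] by metis
qed (use mem_superposition_aut_iff[OF a] in blast)

text \<open>Conjugation by \<zeta> relates the two automorphism groups, because each
  \<open>w m\<close> is absorbed by \<open>W m\<close>, and conjugation keeps the sign.\<close>

lemma even_superposition_aut_same_superposition:
  assumes ab: "(a, b) \<in> same_superposition d k W"
    and even: "\<forall>\<sigma>\<in>superposition_aut k W a. evenperm \<sigma>"
  shows "\<forall>\<sigma>\<in>superposition_aut k W b. evenperm \<sigma>"
proof
  fix \<sigma> assume \<sigma>: "\<sigma> \<in> superposition_aut k W b"
  obtain \<zeta> w where a: "a \<in> placements d k" and b: "b \<in> placements d k" and \<zeta>: "\<zeta> \<in> Sym d"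
    and w: "\<And>m. m \<in> {1..k} \<Longrightarrow> w m \<in> W m \<and> b m = \<zeta> \<circ> a m \<circ> w m"
    using ab unfolding same_superposition_def by blast
  have \<sigma>': "\<sigma> \<in> Sym d"
    using \<sigma> mem_superposition_aut_iff[OF b] by blast
  define \<tau> where "\<tau> = perm_inv \<zeta> \<circ> \<sigma> \<circ> \<zeta>"
  have \<tau>': "\<tau> \<in> Sym d"
    unfolding \<tau>_def by (intro Sym_comp Sym_inv \<zeta> \<sigma>')
  have "perm_inv (a m) \<circ> \<tau> \<circ> a m \<in> W m" if m: "m \<in> {1..k}" for m
  proof -
    have wm: "w m \<in> W m" "w m \<in> Sym d"
      using w[OF m] perm_subgroupD(1)[OF W[OF m]] by blast+
    note am = placementD[OF a m]
    have bm: "b m = \<zeta> \<circ> a m \<circ> w m"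
      using w[OF m] by blast
    have "perm_inv (b m) = perm_inv (w m) \<circ> perm_inv (a m) \<circ> perm_inv \<zeta>"
      unfolding bm Sym_inv_comp[OF Sym_comp[OF \<zeta> am] wm(2)] Sym_inv_comp[OF \<zeta> am]
      by (simp only: comp_assoc)
    then have "perm_inv (a m) \<circ> \<tau> \<circ> a m = w m \<circ> (perm_inv (b m) \<circ> \<sigma> \<circ> b m) \<circ> perm_inv (w m)"
      by (simp only: \<tau>_def bm comp_assoc Sym_cancel[OF wm(2)] comp_id)
    moreover have "perm_inv (b m) \<circ> \<sigma> \<circ> b m \<in> W m"
      using \<sigma> m mem_superposition_aut_iff[OF b] by blast
    ultimately show ?thesis
      using wm(1) by (simp only: perm_subgroupD(3,4)[OF W[OF m]])
  qed
  then have "\<tau> \<in> superposition_aut k W a"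
    using \<tau>' mem_superposition_aut_iff[OF a] by blast
  then have "evenperm \<tau>"
    using even by blast
  moreover have "\<sigma> = \<zeta> \<circ> \<tau> \<circ> perm_inv \<zeta>"
    by (simp only: \<tau>_def comp_assoc Sym_cancel[OF \<zeta>] comp_id)
  \<comment> \<open>The sign is viewed in \<open>rat\<close> so that the conjugation lemma for
    field-valued linear characters applies.\<close>
  then have "(of_int (sign \<sigma>) :: rat) = of_int (sign \<tau>)"
    by (simp only: linear_character_conjugate[OF linear_character_sign \<tau>' \<zeta>])
  ultimately show "evenperm \<sigma>"
    by (simp add: sign_def split: if_splits)
qed

text \<open>Orbit-stabilizer for the action of $S_d \times W_1 \times \dots \times W_k$ on the placements.\<close>

lemma card_superposition_mult_card_aut:
  assumes a: "a \<in> placements d k"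
  shows "card (same_superposition d k W `` {a}) * card (superposition_aut k W a)
    = fact d * (\<Prod>m=1..k. card (W m))"
proof -
  define D where "D = Sym d \<times> Pi\<^sub>E {1..k} W"
  define f where "f = (\<lambda>(\<zeta>, w). move \<zeta> a w)"
  have "finite (Pi\<^sub>E {1..k} W)"
    by (intro finite_PiE finite_atLeastAtMost finite_perm_subgroup[OF W])
  then have fin: "finite D"
    unfolding D_def using finite_Sym by (rule finite_cartesian_product[rotated])
  have image: "f ` D = same_superposition d k W `` {a}"
    using a by (force simp: same_superposition_iff f_def D_def)
  have fibre: "card {p. p \<in> D \<and> f p = b} = card (superposition_aut k W a)" if b: "b \<in> f ` D" for b
  proof -
    obtain \<zeta>0 w0 where \<zeta>0: "\<zeta>0 \<in> Sym d" and w0: "w0 \<in> Pi\<^sub>E {1..k} W" and b: "b = move \<zeta>0 a w0"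
      using b by (auto simp: D_def f_def)
    \<comment> \<open>If \<zeta> a_m w_m = \<zeta>0 a_m w0_m and \<zeta> = \<zeta>0 \<alpha>, then
      w_m is forced to be a_m^-1 \<alpha>^-1 a_m w0_m. It lies in W_m for all m exactly when
      \<alpha> is an automorphism, so these parametrize the fibre.\<close>
    define g where "g \<alpha> = (\<zeta>0 \<circ> \<alpha>, \<lambda>m\<in>{1..k}. perm_inv (a m) \<circ> perm_inv \<alpha> \<circ> a m \<circ> w0 m)" for \<alpha>
    have "bij_betw g (superposition_aut k W a) {p. p \<in> D \<and> f p = b}"
    proof (rule bij_betw_byWitness[where f' = "\<lambda>(\<zeta>, w). perm_inv \<zeta>0 \<circ> \<zeta>"])
      show "\<forall>\<alpha>\<in>superposition_aut k W a. (\<lambda>(\<zeta>, w). perm_inv \<zeta>0 \<circ> \<zeta>) (g \<alpha>) = \<alpha>"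
        by (simp only: g_def prod.case Sym_cancel[OF \<zeta>0]) blast
      show "\<forall>p\<in>{p. p \<in> D \<and> f p = b}. g ((\<lambda>(\<zeta>, w). perm_inv \<zeta>0 \<circ> \<zeta>) p) = p"
      proof
        fix p assume p: "p \<in> {p. p \<in> D \<and> f p = b}"
        obtain \<zeta> w where pw: "p = (\<zeta>, w)"
          by (cases p)
        have \<zeta>: "\<zeta> \<in> Sym d" and w: "w \<in> Pi\<^sub>E {1..k} W" and eq: "move \<zeta> a w = move \<zeta>0 a w0"
          using p by (simp_all add: pw D_def f_def b)
        have "(\<lambda>m\<in>{1..k}. perm_inv (a m) \<circ> perm_inv (perm_inv \<zeta>0 \<circ> \<zeta>) \<circ> a m \<circ> w0 m) = w"
        proof (rule extensionalityI[where A = "{1..k}"])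
          show "w \<in> extensional {1..k}"
            using w by (simp add: PiE_def)
          fix m assume m: "m \<in> {1..k}"
          have "\<zeta> \<circ> (a m \<circ> w m) = \<zeta>0 \<circ> (a m \<circ> w0 m)"
            using fun_cong[OF eq, of m] by (simp only: move_apply[OF m] comp_assoc)
          then have "perm_inv (a m) \<circ> (perm_inv \<zeta> \<circ> (\<zeta> \<circ> (a m \<circ> w m)))
              = perm_inv (a m) \<circ> (perm_inv \<zeta> \<circ> (\<zeta>0 \<circ> (a m \<circ> w0 m)))"
            by (simp only:)
          then have "w m = perm_inv (a m) \<circ> (perm_inv \<zeta> \<circ> (\<zeta>0 \<circ> (a m \<circ> w0 m)))"
            by (simp only: Sym_cancel[OF \<zeta>] Sym_cancel[OF placementD[OF a m]])
          then show "(\<lambda>m\<in>{1..k}. perm_inv (a m) \<circ> perm_inv (perm_inv \<zeta>0 \<circ> \<zeta>) \<circ> a m \<circ> w0 m) m = w m"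
            using m by (simp only: restrict_apply' Sym_inv_comp[OF Sym_inv[OF \<zeta>0] \<zeta>] Sym_inv_inv[OF \<zeta>0] comp_assoc)
        qed (rule restrict_extensional)
        then show "g ((\<lambda>(\<zeta>, w). perm_inv \<zeta>0 \<circ> \<zeta>) p) = p"
          by (simp only: pw prod.case g_def Sym_cancel[OF \<zeta>0])
      qed
      show "g ` superposition_aut k W a \<subseteq> {p. p \<in> D \<and> f p = b}"
      proof (rule image_subsetI)
        fix \<alpha> assume \<alpha>: "\<alpha> \<in> superposition_aut k W a"
        then have \<alpha>': "\<alpha> \<in> Sym d" and inv: "perm_inv \<alpha> \<in> superposition_aut k W a"
          using perm_subgroupD[OF perm_subgroup_superposition_aut[OF a]] by blast+
        have mem: "perm_inv (a m) \<circ> perm_inv \<alpha> \<circ> a m \<circ> w0 m \<in> W m" if m: "m \<in> {1..k}" for m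
          using perm_subgroupD(3)[OF W[OF m] _ PiE_mem[OF w0 m]] inv m
          unfolding mem_superposition_aut_iff[OF a] by blast
        then have "g \<alpha> \<in> D"
          using Sym_comp[OF \<zeta>0 \<alpha>'] unfolding g_def D_def mem_Sigma_iff restrict_PiE_iff by blast
        moreover have "f (g \<alpha>) = b"
          unfolding f_def g_def b prod.case
        proof (rule placement_eqI)
          show "move (\<zeta>0 \<circ> \<alpha>) a (\<lambda>m\<in>{1..k}. perm_inv (a m) \<circ> perm_inv \<alpha> \<circ> a m \<circ> w0 m) \<in> placements d k"
            using mem by (intro move_placement a Sym_comp[OF \<zeta>0 \<alpha>']) (simp only: restrict_apply')
          show "move \<zeta>0 a w0 \<in> placements d k"
            using w0 by (intro move_placement a \<zeta>0) (rule PiE_mem)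
          fix m assume m: "m \<in> {1..k}"
          show "move (\<zeta>0 \<circ> \<alpha>) a (\<lambda>m\<in>{1..k}. perm_inv (a m) \<circ> perm_inv \<alpha> \<circ> a m \<circ> w0 m) m = move \<zeta>0 a w0 m"
            by (simp only: move_apply[OF m] restrict_apply'[OF m] comp_assoc
                Sym_cancel[OF placementD[OF a m]] Sym_cancel[OF \<alpha>'])
        qed
        ultimately show "g \<alpha> \<in> {p. p \<in> D \<and> f p = b}"
          by blast
      qed
      show "(\<lambda>(\<zeta>, w). perm_inv \<zeta>0 \<circ> \<zeta>) ` {p. p \<in> D \<and> f p = b} \<subseteq> superposition_aut k W a"
      proof (rule image_subsetI)
        fix p assume p: "p \<in> {p. p \<in> D \<and> f p = b}"
        obtain \<zeta> w where pw: "p = (\<zeta>, w)"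
          by (cases p)
        have \<zeta>: "\<zeta> \<in> Sym d" and w: "w \<in> Pi\<^sub>E {1..k} W" and eq: "move \<zeta> a w = move \<zeta>0 a w0"
          using p by (simp_all add: pw D_def f_def b)
        \<comment> \<open>Solving the equation of the two placements shows that this conjugate is
          \<open>w0 m \<circ> perm_inv (w m)\<close>.\<close>
        have "perm_inv (a m) \<circ> (perm_inv \<zeta>0 \<circ> \<zeta>) \<circ> a m \<in> W m" if m: "m \<in> {1..k}" for m
        proof -
          have wm: "w m \<in> W m" "w0 m \<in> W m" "w m \<in> Sym d"
            using PiE_mem[OF w m] PiE_mem[OF w0 m] perm_subgroupD(1)[OF W[OF m]] by blast+
          have "\<zeta> \<circ> (a m \<circ> w m) = \<zeta>0 \<circ> (a m \<circ> w0 m)"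
            using fun_cong[OF eq, of m] by (simp only: move_apply[OF m] comp_assoc)
          then have "perm_inv (a m) \<circ> (perm_inv \<zeta>0 \<circ> (\<zeta> \<circ> (a m \<circ> w m))) = w0 m"
            by (simp only: Sym_cancel[OF \<zeta>0] Sym_cancel[OF placementD[OF a m]])
          then have "w0 m \<circ> perm_inv (w m)
              = perm_inv (a m) \<circ> (perm_inv \<zeta>0 \<circ> (\<zeta> \<circ> (a m \<circ> w m))) \<circ> perm_inv (w m)"
            by (simp only:)
          also have "\<dots> = perm_inv (a m) \<circ> (perm_inv \<zeta>0 \<circ> \<zeta>) \<circ> a m"
            by (simp only: comp_assoc Sym_cancel[OF wm(3)] comp_id)
          finally show ?thesis
            using perm_subgroupD(3)[OF W[OF m] wm(2) perm_subgroupD(4)[OF W[OF m] wm(1)]] by (simp only:)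
        qed
        then show "(\<lambda>(\<zeta>, w). perm_inv \<zeta>0 \<circ> \<zeta>) p \<in> superposition_aut k W a"
          using Sym_comp[OF Sym_inv[OF \<zeta>0] \<zeta>] unfolding pw prod.case mem_superposition_aut_iff[OF a] by blast
      qed
    qed
    then show ?thesis
      by (rule bij_betw_same_card[symmetric])
  qed
  have "fact d * (\<Prod>m=1..k. card (W m)) = card D"
    unfolding D_def card_cartesian_product card_Sym by (simp add: card_PiE)
  also have "\<dots> = (\<Sum>b\<in>f ` D. card {p. p \<in> D \<and> f p = b})"
    unfolding card_eq_sum by (rule sum.image_gen[OF fin])
  also have "\<dots> = card (f ` D) * card (superposition_aut k W a)"
    using fibre by simp
  finally show ?thesis
    by (simp only: image)
qed

text \<open>Evenness passes between equivalent placements, so one representative decides.\<close>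

lemma even_superposition_class_iff:
  assumes S: "S \<in> superpositions d k W" and a: "a \<in> S"
  shows "even_superposition k W S \<longleftrightarrow> (\<forall>\<sigma>\<in>superposition_aut k W a. evenperm \<sigma>)"
proof -
  have "(a, b) \<in> same_superposition d k W" if "b \<in> S" for b
    using quotient_eq_iff[OF equiv_same_superposition S[unfolded superpositions_def] S[unfolded superpositions_def] a that]
    by simp
  then show ?thesis
    using a even_superposition_aut_same_superposition unfolding even_superposition_def by blast
qed

text \<open>By orbit-stabilizer, the stabilizer sizes over one class add up to the same number
  whatever the size of the class; classes that are not even contribute 0.\<close>

lemma sum_card_even_aut:
  "(\<Sum>a\<in>placements d k. if \<forall>\<sigma>\<in>superposition_aut k W a. evenperm \<sigma>
      then of_nat (card (superposition_aut k W a)) else 0)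
    = of_nat (card {S \<in> superpositions d k W. even_superposition k W S}) *
      (fact d * (\<Prod>m=1..k. of_nat (card (W m))) :: 'a::field_char_0)"
  (is "sum ?h _ = _ * ?N")
proof -
  let ?R = "same_superposition d k W"
  have Un: "\<Union> (superpositions d k W) = placements d k"
    unfolding superpositions_def by (rule Union_quotient[OF equiv_same_superposition])
  have sub: "S \<subseteq> placements d k" if "S \<in> superpositions d k W" for S
    using that Un by blast
  have fin_S: "finite S" if "S \<in> superpositions d k W" for S
    using sub[OF that] finite_placements by (rule finite_subset)
  have fin: "finite (superpositions d k W)"
    using finite_UnionD[of "superpositions d k W"] finite_placements unfolding Un by blast
  have disj: "\<forall>A\<in>superpositions d k W. \<forall>B\<in>superpositions d k W. A \<noteq> B \<longrightarrow> A \<inter> B = {}"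
    unfolding superpositions_def using quotient_disj[OF equiv_same_superposition] by blast
  have "sum ?h (placements d k) = (\<Sum>S\<in>superpositions d k W. sum ?h S)"
    using sum.Union_disjoint[OF _ disj, of ?h] fin_S unfolding Un by simp
  also have "\<dots> = (\<Sum>S\<in>superpositions d k W. if even_superposition k W S then ?N else 0)"
  proof (rule sum.cong[OF refl])
    fix S assume S: "S \<in> superpositions d k W"
    have h: "?h a = (if even_superposition k W S then ?N / of_nat (card S) else 0)" if a: "a \<in> S" for a
    proof -
      have "S = ?R `` {a}"
        using S a quotientE[OF S[unfolded superpositions_def]] equiv_class_eq[OF equiv_same_superposition]
        by (metis Image_singleton_iff)
      then have "card S * card (superposition_aut k W a) = fact d * (\<Prod>m=1..k. card (W m))"
        using card_superposition_mult_card_aut[of a] sub[OF S] a by blast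
      then have "(of_nat (card S * card (superposition_aut k W a)) :: 'a) = of_nat (fact d * (\<Prod>m=1..k. card (W m)))"
        by (rule arg_cong)
      moreover have "card S \<noteq> 0"
        using a fin_S[OF S] by auto
      ultimately have "of_nat (card (superposition_aut k W a)) = ?N / of_nat (card S)"
        by (simp add: field_simps)
      then show ?thesis
        using even_superposition_class_iff[OF S a] by simp
    qed
    have "S \<noteq> {}"
      using S in_quotient_imp_non_empty[OF equiv_same_superposition] unfolding superpositions_def by blast
    then have "of_nat (card S) \<noteq> (0 :: 'a)"
      using fin_S[OF S] by simp
    moreover have "sum ?h S = (\<Sum>a\<in>S. if even_superposition k W S then ?N / of_nat (card S) else 0)"
      using h by (rule sum.cong[OF refl])
    ultimately show "sum ?h S = (if even_superposition k W S then ?N else 0)"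
      by simp
  qed
  also have "\<dots> = (\<Sum>S\<in>{S \<in> superpositions d k W. even_superposition k W S}. ?N)"
    by (rule sum.inter_filter[OF fin, symmetric])
  finally show ?thesis
    by simp
qed

text \<open>Orbit counting weighted by the sign: pairs (\<sigma>, a) with \<sigma> an automorphism
  of a are summed in both orders. Multiplying by the product of the |W_m| first turns tuples of
  fixed cosets into placements.\<close>

lemma sum_sign_prod_card_fixed_cosets:
  "(\<Sum>\<sigma>\<in>Sym d. of_int (sign \<sigma>) * (\<Prod>m=1..k. of_nat (card (fixed_cosets d (W m) \<sigma>))))
    = fact d * (of_nat (card {S \<in> superpositions d k W. even_superposition k W S}) :: 'a::field_char_0)"
proof -
  let ?N = "\<Prod>m=1..k. of_nat (card (W m)) :: 'a"
  \<comment> \<open>For fixed \<sigma> the condition on a splits into independent conditions on the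
    \<open>a m\<close>, so the count becomes a product.\<close>
  have placements: "{a \<in> placements d k. \<sigma> \<in> superposition_aut k W a}
      = (\<Pi>\<^sub>E m\<in>{1..k}. {\<tau> \<in> Sym d. perm_inv \<tau> \<circ> \<sigma> \<circ> \<tau> \<in> W m})" if "\<sigma> \<in> Sym d" for \<sigma>
  proof (rule Set.set_eqI)
    fix a
    have "a \<in> placements d k \<and> \<sigma> \<in> superposition_aut k W a
        \<longleftrightarrow> a \<in> placements d k \<and> (\<forall>m\<in>{1..k}. perm_inv (a m) \<circ> \<sigma> \<circ> a m \<in> W m)"
      using mem_superposition_aut_iff that by blast
    then show "a \<in> {a \<in> placements d k. \<sigma> \<in> superposition_aut k W a}
        \<longleftrightarrow> a \<in> (\<Pi>\<^sub>E m\<in>{1..k}. {\<tau> \<in> Sym d. perm_inv \<tau> \<circ> \<sigma> \<circ> \<tau> \<in> W m})"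
      unfolding placements_def PiE_iff mem_Collect_eq by blast
  qed
  have prod: "?N * (\<Prod>m=1..k. of_nat (card (fixed_cosets d (W m) \<sigma>)))
      = of_nat (card {a \<in> placements d k. \<sigma> \<in> superposition_aut k W a})" if \<sigma>: "\<sigma> \<in> Sym d" for \<sigma>
  proof -
    have "?N * (\<Prod>m=1..k. of_nat (card (fixed_cosets d (W m) \<sigma>)))
        = (\<Prod>m=1..k. of_nat (card (W m) * card (fixed_cosets d (W m) \<sigma>)))"
      by (simp add: prod.distrib)
    also have "\<dots> = (\<Prod>m=1..k. of_nat (card {\<tau> \<in> Sym d. perm_inv \<tau> \<circ> \<sigma> \<circ> \<tau> \<in> W m}))"
      by (intro prod.cong refl) (simp only: card_fixed_cosets[OF W \<sigma>])
    also have "\<dots> = of_nat (card {a \<in> placements d k. \<sigma> \<in> superposition_aut k W a})"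
      unfolding placements[OF \<sigma>] by (simp only: card_PiE[OF finite_atLeastAtMost] of_nat_prod)
    finally show ?thesis .
  qed
  have "?N * (\<Sum>\<sigma>\<in>Sym d. of_int (sign \<sigma>) * (\<Prod>m=1..k. of_nat (card (fixed_cosets d (W m) \<sigma>))))
      = (\<Sum>\<sigma>\<in>Sym d. of_nat (card {a \<in> placements d k. \<sigma> \<in> superposition_aut k W a}) * of_int (sign \<sigma>))"
    unfolding sum_distrib_left by (intro sum.cong refl) (simp only: prod[symmetric] mult_ac)
  also have "\<dots> = (\<Sum>\<sigma>\<in>Sym d. \<Sum>a\<in>placements d k. if \<sigma> \<in> superposition_aut k W a then of_int (sign \<sigma>) else 0)"
    by (intro sum.cong refl) (simp only: sum.inter_filter[OF finite_placements, symmetric] sum_constant)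
  also have "\<dots> = (\<Sum>a\<in>placements d k. \<Sum>\<sigma>\<in>Sym d. if \<sigma> \<in> superposition_aut k W a then of_int (sign \<sigma>) else 0)"
    by (rule sum.swap)
  also have "\<dots> = (\<Sum>a\<in>placements d k. \<Sum>\<sigma>\<in>superposition_aut k W a. of_int (sign \<sigma>))"
  proof (rule sum.cong[OF refl])
    fix a assume "a \<in> placements d k"
    then have "{\<sigma> \<in> Sym d. \<sigma> \<in> superposition_aut k W a} = superposition_aut k W a"
      using perm_subgroupD(1)[OF perm_subgroup_superposition_aut] by blast
    then show "(\<Sum>\<sigma>\<in>Sym d. if \<sigma> \<in> superposition_aut k W a then of_int (sign \<sigma>) else 0)
        = (\<Sum>\<sigma>\<in>superposition_aut k W a. of_int (sign \<sigma>) :: 'a)"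
      by (simp only: sum.inter_filter[OF finite_Sym, symmetric])
  qed
  also have "\<dots> = (\<Sum>a\<in>placements d k. if \<forall>\<sigma>\<in>superposition_aut k W a. evenperm \<sigma>
      then of_nat (card (superposition_aut k W a)) else 0)"
    by (intro sum.cong refl sum_sign_perm_subgroup[where d = d] perm_subgroup_superposition_aut)
  also have "\<dots> = of_nat (card {S \<in> superpositions d k W. even_superposition k W S}) * (fact d * ?N)"
    by (rule sum_card_even_aut)
  finally have "?N * (\<Sum>\<sigma>\<in>Sym d. of_int (sign \<sigma>) * (\<Prod>m=1..k. of_nat (card (fixed_cosets d (W m) \<sigma>))))
      = ?N * (fact d * of_nat (card {S \<in> superpositions d k W. even_superposition k W S}))"
    by (simp only: mult_ac)
  moreover have "?N \<noteq> 0"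
    using card_perm_subgroup_pos[OF W] by simp
  ultimately show ?thesis
    by (simp only: mult_cancel_left) simp
qed

end

theorem corollary3p1p4:
  fixes d k :: nat
    and \<Gamma> :: "nat \<Rightarrow> multigraph"
    and W :: "nat \<Rightarrow> (nat \<Rightarrow> nat) set"
  assumes "d \<ge> 1" and "k \<ge> 1"
    and "\<And>m. m \<in> {1..k} \<Longrightarrow> multigraph_on d (\<Gamma> m)"
    and "\<And>m. m \<in> {1..k} \<Longrightarrow> W m = aut_group d (\<Gamma> m)"
  shows "(of_nat (card {S \<in> superpositions d k W. even_superposition k W S})
            :: 'a::{alg_closed_field, field_char_0})
    = power_sum_coeff_sum d (foldl (internal_prod d)
             (cycle_index d (W 1) (\<lambda>\<sigma>\<in>W 1. of_int (sign \<sigma>)))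
             (map (\<lambda>m. cycle_index d (W m) (\<lambda>\<sigma>\<in>W m. 1)) [2..<k + 1]))"
proof -
  have W: "perm_subgroup d (W m)" if "m \<in> {1..k}" for m
    using assms(4)[OF that] perm_subgroup_aut_group by simp
  let ?u = "\<lambda>\<sigma>. of_int (sign \<sigma>) * (\<Prod>m=1..k. of_nat (card (fixed_cosets d (W m) \<sigma>))) :: 'a"
  have "power_sum_coeff_sum d (foldl (internal_prod d)
             (cycle_index d (W 1) (\<lambda>\<sigma>\<in>W 1. of_int (sign \<sigma>)))
             (map (\<lambda>m. cycle_index d (W m) (\<lambda>\<sigma>\<in>W m. 1)) [2..<k + 1]))
      = power_sum_coeff_sum d (ch d (\<lambda>\<sigma>\<in>Sym d. ?u \<sigma>))"
    by (intro arg_cong[where f = "power_sum_coeff_sum d"] foldl_internal_prod_cycle_index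
        linear_character_sign assms(2) W)
  also have "\<dots> = (\<Sum>\<sigma>\<in>Sym d. ?u \<sigma>) / fact d"
    unfolding power_sum_coeff_sum_ch by (intro arg_cong2[where f = "(/)"] sum.cong refl) (simp only: restrict_apply')
  also have "\<dots> = of_nat (card {S \<in> superpositions d k W. even_superposition k W S})"
    by (subst sum_sign_prod_card_fixed_cosets[OF assms(2)]) (simp_all only: W nonzero_mult_div_cancel_left fact_nonzero not_False_eq_True)
  finally show ?thesis ..
qed

end
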